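(* Let $\mathfrak{g}=\mathfrak{gl}(m|n)$. There exists a $\mathfrak{g}_0$-module isomorphism $$M(\mathfrak{g}_1)\simeq\mathbb{C}[x_1,\dots,x_{mn}]\otimes\mathbb{C}_{-\rho_1},$$ where $\mathfrak{g}_0$ acts on $M(\mathfrak{g}_1)$ through $\alpha:\mathfrak{g}_0\to W(\mathfrak{g}_1)$ and on $\mathbb{C}[x_1,\dots,x_{mn}]$ by the natural adjoint action.
   Context: $\mathfrak{g}=\mathfrak{gl}(m|n)$ is the complex general linear Lie superalgebra with matrix units $E_{ij}$ and superbracket $[\cdot,\cdot]$. Even part: $\mathfrak{g}_0=\sum_{i,j\le m}\mathbb{C}E_{ij}+\sum_{k,l>m}\mathbb{C}E_{kl}$; Cartan subalgebra $\mathfrak{h}_0=\sum_i\mathbb{C}E_{ii}$. Odd part: $\mathfrak{g}_1=\mathfrak{g}_+\oplus\mathfrak{g}_-$ with $\mathfrak{g}_+=\sum_{i\le m<k}\mathbb{C}E_{ik}$, $\mathfrak{g}_-=\sum_{i\le m<k}\mathbb{C}E_{ki}$ (both $\mathfrak{g}_0$-invariant). $\Delta_1^+$ is the set of weights of $\mathfrak{h}_0$ on $\mathfrak{g}_+$, $\rho_1=\frac12\sum_{\beta\in\Delta_1^+}\beta$, and $\mathbb{C}_{-\rho_1}$ is the one-dimensional $\mathfrak{g}_0$-module of weight $-\rho_1$. $B(X,Y)=\frac12\mathrm{str}(XY)$, with $\mathrm{str}A=\sum_{i\le m}a_{ii}-\sum_{j>m}a_{jj}$. For $i\le m<k$ put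 $\partial_{(i-1)n+(k-m)}=E_{ik}$ and $x_{(i-1)n+(k-m)}=E_{ki}$; these are bases of $\mathfrak{g}_+$ and $\mathfrak{g}_-$ with $B(\partial_i,x_j)=\frac12\delta_{ij}$. $W(\mathfrak{g}_1)$ is the Weyl algebra generated by the $\partial_i,x_i$ ($1\le i\le mn$) with $[x_i,x_j]_W=[\partial_i,\partial_j]_W=0$, $[\partial_i,x_j]_W=\delta_{ij}$. The Weil representation $M(\mathfrak{g}_1)$ is the space $\mathbb{C}[x_1,\dots,x_{mn}]$ with $x_i\in W(\mathfrak{g}_1)$ acting by multiplication and $\partial_i$ by $\partial/\partial x_i$. The Lie algebra morphism $\alpha:\mathfrak{g}_0\to W(\mathfrak{g}_1)$ is $$\alpha(X)=-\sum_{i,j}2B(X,[x_i,\partial_j])\,x_j\partial_i-\sum_iB(X,[\partial_i,x_i]).$$ The polynomial algebra $\mathbb{C}[x_1,\dots,x_{mn}]=S(\mathfrak{g}_-)$ is also a $\mathfrak{g}_0$-module under the natural adjoint action, i.e. the adjoint action of $\mathfrak{g}_0$ on $\mathfrak{g}_-$ extended by derivations. *)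

theory Defs
  imports
    "HOL-Library.Poly_Mapping"
    "HOL-Library.FuncSet"
    "HOL-Algebra.QuotRing"
    "HOL-Algebra.Module"
    "Jordan_Normal_Form.Matrix"
begin

section \<open>The Lie superalgebra gl(m|n)\<close>

text \<open>
  Elements of gl(m|n) are complex square matrices of size m + n. Rows, columns and the
  variables of the polynomial ring are numbered from 0, so the even indices are i < m, the
  odd ones m \<le> k < m + n, and the variables are x_a with a < m * n.
\<close>

definition gl :: "nat \<Rightarrow> nat \<Rightarrow> complex mat set" where
  "gl m n = carrier_mat (m + n) (m + n)"

definition E :: "nat \<Rightarrow> nat \<Rightarrow> nat \<Rightarrow> nat \<Rightarrow> complex mat" where
  "E m n i j = mat (m + n) (m + n) (\<lambda>(r, s). if r = i \<and> s = j then 1 else 0)"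

definition g0 :: "nat \<Rightarrow> nat \<Rightarrow> complex mat set" where
  "g0 m n = {X \<in> gl m n. \<forall>i < m + n. \<forall>j < m + n. (i < m) \<noteq> (j < m) \<longrightarrow> X $$ (i, j) = 0}"

definition h0 :: "nat \<Rightarrow> nat \<Rightarrow> complex mat set" where
  "h0 m n = {X \<in> gl m n. \<forall>i < m + n. \<forall>j < m + n. i \<noteq> j \<longrightarrow> X $$ (i, j) = 0}"

definition gplus :: "nat \<Rightarrow> nat \<Rightarrow> complex mat set" where
  "gplus m n = {X \<in> gl m n. \<forall>i < m + n. \<forall>j < m + n. \<not> (i < m \<and> m \<le> j) \<longrightarrow> X $$ (i, j) = 0}"

definition gminus :: "nat \<Rightarrow> nat \<Rightarrow> complex mat set" where
  "gminus m n = {X \<in> gl m n. \<forall>i < m + n. \<forall>j < m + n. \<not> (j < m \<and> m \<le> i) \<longrightarrow> X $$ (i, j) = 0}"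

definition even_part :: "nat \<Rightarrow> nat \<Rightarrow> complex mat \<Rightarrow> complex mat" where
  "even_part m n X = mat (m + n) (m + n) (\<lambda>(i, j). if (i < m) = (j < m) then X $$ (i, j) else 0)"

definition odd_part :: "nat \<Rightarrow> nat \<Rightarrow> complex mat \<Rightarrow> complex mat" where
  "odd_part m n X = mat (m + n) (m + n) (\<lambda>(i, j). if (i < m) = (j < m) then 0 else X $$ (i, j))"

text \<open>The bilinear extension of XY - (-1)^(|X||Y|) YX from homogeneous X and Y.\<close>

definition sbracket :: "nat \<Rightarrow> nat \<Rightarrow> complex mat \<Rightarrow> complex mat \<Rightarrow> complex mat" where
  "sbracket m n X Y = X * Y -
     (even_part m n Y * even_part m n X + even_part m n Y * odd_part m n X
      + odd_part m n Y * even_part m n X - odd_part m n Y * odd_part m n X)"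

definition str :: "nat \<Rightarrow> nat \<Rightarrow> complex mat \<Rightarrow> complex" where
  "str m n A = (\<Sum>i<m. A $$ (i, i)) - (\<Sum>j\<in>{m..<m + n}. A $$ (j, j))"

definition B :: "nat \<Rightarrow> nat \<Rightarrow> complex mat \<Rightarrow> complex mat \<Rightarrow> complex" where
  "B m n X Y = 1 / 2 * str m n (X * Y)"

text \<open>
  The index a = i * n + (k - m) encodes the pair of i < m and m \<le> k < m + n; the two lemmas
  below state the definitions in terms of i and k.
\<close>

definition dbas :: "nat \<Rightarrow> nat \<Rightarrow> nat \<Rightarrow> complex mat" where
  "dbas m n a = E m n (a div n) (m + a mod n)"

definition xbas :: "nat \<Rightarrow> nat \<Rightarrow> nat \<Rightarrow> complex mat" where
  "xbas m n a = E m n (m + a mod n) (a div n)"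

lemma pair_index:
  fixes i k m n :: nat
  assumes "m \<le> k" "k < m + n"
  shows "(i * n + (k - m)) div n = i" "m + (i * n + (k - m)) mod n = k"
proof -
  have lt: "k - m < n" using assms by simp
  show "(i * n + (k - m)) div n = i" using lt by (simp add: div_add1_eq)
  have "(i * n + (k - m)) mod n = k - m" using lt by (metis add.commute mod_less mod_mult_self1)
  then show "m + (i * n + (k - m)) mod n = k" using assms by simp
qed

lemma dbas_index: "m \<le> k \<Longrightarrow> k < m + n \<Longrightarrow> dbas m n (i * n + (k - m)) = E m n i k"
  by (simp only: dbas_def pair_index)

lemma xbas_index: "m \<le> k \<Longrightarrow> k < m + n \<Longrightarrow> xbas m n (i * n + (k - m)) = E m n k i"
  by (simp only: xbas_def pair_index)


section \<open>Modules over the even part\<close>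

definition complex_ring :: "complex ring" where
  "complex_ring = \<lparr>carrier = UNIV, monoid.mult = (*), one = 1, zero = 0, add = (+)\<rparr>"

text \<open>
  The fields \<open>mult\<close> and \<open>one\<close>, which the record of library modules inherits from rings,
  play no role below.
\<close>

record 'v g0_mod = "(complex, 'v) module" +
  gact :: "complex mat \<Rightarrow> 'v \<Rightarrow> 'v"

definition g0_module :: "nat \<Rightarrow> nat \<Rightarrow> 'v g0_mod \<Rightarrow> bool" where
  "g0_module m n V \<longleftrightarrow>
     module complex_ring V \<and>
     (\<forall>X\<in>g0 m n. \<forall>v\<in>carrier V. gact V X v \<in> carrier V) \<and>
     (\<forall>X\<in>g0 m n. \<forall>v\<in>carrier V. \<forall>w\<in>carrier V.
        gact V X (v \<oplus>\<^bsub>V\<^esub> w) = gact V X v \<oplus>\<^bsub>V\<^esub> gact V X w) \<and>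
     (\<forall>X\<in>g0 m n. \<forall>c. \<forall>v\<in>carrier V. gact V X (c \<odot>\<^bsub>V\<^esub> v) = c \<odot>\<^bsub>V\<^esub> gact V X v) \<and>
     (\<forall>X\<in>g0 m n. \<forall>Y\<in>g0 m n. \<forall>v\<in>carrier V. gact V (X + Y) v = gact V X v \<oplus>\<^bsub>V\<^esub> gact V Y v) \<and>
     (\<forall>X\<in>g0 m n. \<forall>c. \<forall>v\<in>carrier V. gact V (c \<cdot>\<^sub>m X) v = c \<odot>\<^bsub>V\<^esub> gact V X v) \<and>
     (\<forall>X\<in>g0 m n. \<forall>Y\<in>g0 m n. \<forall>v\<in>carrier V.
        gact V (sbracket m n X Y) v = gact V X (gact V Y v) \<ominus>\<^bsub>V\<^esub> gact V Y (gact V X v))"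

definition g0_iso :: "nat \<Rightarrow> nat \<Rightarrow> 'v g0_mod \<Rightarrow> 'w g0_mod \<Rightarrow> ('v \<Rightarrow> 'w) \<Rightarrow> bool" where
  "g0_iso m n V W \<phi> \<longleftrightarrow>
     g0_module m n V \<and> g0_module m n W \<and>
     bij_betw \<phi> (carrier V) (carrier W) \<and>
     (\<forall>v\<in>carrier V. \<forall>w\<in>carrier V. \<phi> (v \<oplus>\<^bsub>V\<^esub> w) = \<phi> v \<oplus>\<^bsub>W\<^esub> \<phi> w) \<and>
     (\<forall>c. \<forall>v\<in>carrier V. \<phi> (c \<odot>\<^bsub>V\<^esub> v) = c \<odot>\<^bsub>W\<^esub> \<phi> v) \<and>
     (\<forall>X\<in>g0 m n. \<forall>v\<in>carrier V. \<phi> (gact V X v) = gact W X (\<phi> v))"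


section \<open>Linear combinations\<close>

definition scl :: "complex \<Rightarrow> ('k \<Rightarrow>\<^sub>0 complex) \<Rightarrow> ('k \<Rightarrow>\<^sub>0 complex)" where
  "scl c p = Poly_Mapping.map ((*) c) p"

definition lin_ext :: "('k \<Rightarrow> ('l \<Rightarrow>\<^sub>0 complex)) \<Rightarrow> ('k \<Rightarrow>\<^sub>0 complex) \<Rightarrow> ('l \<Rightarrow>\<^sub>0 complex)" where
  "lin_ext f p = (\<Sum>k\<in>Poly_Mapping.keys p. scl (Poly_Mapping.lookup p k) (f k))"

lemma lookup_scl [simp]: "Poly_Mapping.lookup (scl c p) k = c * Poly_Mapping.lookup p k"
  unfolding scl_def by (simp add: Poly_Mapping.map.rep_eq when_def)

lemma scl_add: "scl c (p + q) = scl c p + scl c q"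
  by (rule poly_mapping_eqI) (simp add: lookup_add algebra_simps)

lemma scl_add_left: "scl (c + d) p = scl c p + scl d p"
  by (rule poly_mapping_eqI) (simp add: lookup_add algebra_simps)

lemma scl_scl: "scl c (scl d p) = scl (c * d) p"
  by (rule poly_mapping_eqI) simp

lemma scl_0 [simp]: "scl 0 p = 0" "scl c 0 = 0"
  by (rule poly_mapping_eqI, simp)+

lemma scl_1 [simp]: "scl 1 p = p"
  by (rule poly_mapping_eqI) simp

lemma scl_minus: "scl c (- p) = - scl c p" "scl (- c) p = - scl c p"
  by (rule poly_mapping_eqI, simp)+

lemma scl_diff: "scl c (p - q) = scl c p - scl c q"
  by (rule poly_mapping_eqI) (simp add: lookup_minus algebra_simps)

lemma scl_single: "scl c (Poly_Mapping.single k d) = Poly_Mapping.single k (c * d)"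
  by (rule poly_mapping_eqI) (simp add: lookup_single when_def)

lemma scl_sum: "scl c (sum f A) = (\<Sum>a\<in>A. scl c (f a))"
  by (induction A rule: infinite_finite_induct) (simp_all add: scl_add)

lemma scl_mult: "scl c p = Poly_Mapping.single 0 c * p"
  unfolding scl_def by (rule mult_map_scale_conv_mult)

lemma scl_mult_left: "scl c (p * q) = scl c p * (q :: 'k::monoid_add \<Rightarrow>\<^sub>0 complex)"
  by (simp add: scl_mult mult.assoc)

lemma keys_scl: "Poly_Mapping.keys (scl c p) \<subseteq> Poly_Mapping.keys p"
  by (auto simp: in_keys_iff)

lemma lin_ext_superset:
  assumes "finite K" "Poly_Mapping.keys p \<subseteq> K"
  shows "lin_ext f p = (\<Sum>k\<in>K. scl (Poly_Mapping.lookup p k) (f k))"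
  unfolding lin_ext_def
  by (rule sum.mono_neutral_left) (use assms in \<open>auto simp: in_keys_iff\<close>)

lemma lin_ext_add: "lin_ext f (p + q) = lin_ext f p + lin_ext f q"
proof -
  let ?K = "Poly_Mapping.keys p \<union> Poly_Mapping.keys q"
  have "lin_ext f r = (\<Sum>k\<in>?K. scl (Poly_Mapping.lookup r k) (f k))"
    if "r \<in> {p, q, p + q}" for r
    using that keys_add[of p q] by (intro lin_ext_superset) auto
  then show ?thesis by (simp add: lookup_add scl_add_left sum.distrib)
qed

lemma lin_ext_scl: "lin_ext f (scl c p) = scl c (lin_ext f p)"
proof -
  have "lin_ext f (scl c p) = (\<Sum>k\<in>Poly_Mapping.keys p. scl (Poly_Mapping.lookup (scl c p) k) (f k))"
    by (rule lin_ext_superset) (simp_all add: keys_scl)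
  then show ?thesis by (simp add: lin_ext_def scl_sum scl_scl)
qed

lemma lin_ext_single: "lin_ext f (Poly_Mapping.single k c) = scl c (f k)"
  by (simp add: lin_ext_def)

lemma lin_ext_0 [simp]: "lin_ext f 0 = 0"
  by (simp add: lin_ext_def)

lemma lin_ext_minus: "lin_ext f (- p) = - lin_ext f p"
  using lin_ext_scl[of f "-1" p] by (simp add: scl_minus)

lemma lin_ext_diff: "lin_ext f (p - q) = lin_ext f p - lin_ext f q"
  using lin_ext_add[of f p "- q"] by (simp add: lin_ext_minus)

lemma poly_mapping_linear_induct [case_names zero single add]:
  fixes p :: "'k \<Rightarrow>\<^sub>0 complex"
  assumes zero: "P 0"
    and single: "\<And>k c. P (Poly_Mapping.single k c)"
    and add: "\<And>p q. P p \<Longrightarrow> P q \<Longrightarrow> P (p + q)"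
  shows "P p"
proof -
  have *: "P (\<Sum>k\<in>A. Poly_Mapping.single k (Poly_Mapping.lookup p k))" if "finite A" for A
    using that by (induction A) (auto intro: assms)
  have "p = (\<Sum>k\<in>Poly_Mapping.keys p. Poly_Mapping.single k (Poly_Mapping.lookup p k))"
    by (rule poly_mapping_eqI)
       (auto simp: lookup_sum lookup_single when_def in_keys_iff)
  then show ?thesis using *[of "Poly_Mapping.keys p"] by simp
qed


section \<open>Polynomials\<close>

type_synonym cpoly = "(nat \<Rightarrow>\<^sub>0 nat) \<Rightarrow>\<^sub>0 complex"

definition polys :: "nat \<Rightarrow> cpoly set" where
  "polys N = {p. \<forall>t\<in>Poly_Mapping.keys p. Poly_Mapping.keys t \<subseteq> {..<N}}"

definition pvar :: "nat \<Rightarrow> cpoly" where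
  "pvar i = Poly_Mapping.single (Poly_Mapping.single i 1) 1"

definition pdiff :: "nat \<Rightarrow> cpoly \<Rightarrow> cpoly" where
  "pdiff i = lin_ext (\<lambda>t. Poly_Mapping.single (t - Poly_Mapping.single i 1)
                             (of_nat (Poly_Mapping.lookup t i)))"

lemma pdiff_single:
  "pdiff i (Poly_Mapping.single t c) =
     Poly_Mapping.single (t - Poly_Mapping.single i 1) (c * of_nat (Poly_Mapping.lookup t i))"
  by (simp add: pdiff_def lin_ext_single scl_single)

lemma pdiff_add: "pdiff i (p + q) = pdiff i p + pdiff i q"
  by (simp add: pdiff_def lin_ext_add)

lemma pdiff_scl: "pdiff i (scl c p) = scl c (pdiff i p)"
  by (simp add: pdiff_def lin_ext_scl)

lemma pdiff_pvar: "pdiff i (pvar j) = (if i = j then 1 else 0)"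
  by (auto simp: pvar_def pdiff_single lookup_single when_def)

lemma single_diff_add:
  assumes "Poly_Mapping.lookup s i \<noteq> (0::nat)"
  shows "s - Poly_Mapping.single i 1 + t = s + t - Poly_Mapping.single i 1"
  by (rule poly_mapping_eqI) (use assms in \<open>auto simp: lookup_add lookup_minus lookup_single when_def\<close>)

lemma pdiff_mult: "pdiff i (p * q) = pdiff i p * q + p * pdiff i q"
proof (induction p rule: poly_mapping_linear_induct)
  case zero
  then show ?case by (simp add: pdiff_def)
next
  case (add p q)
  then show ?case by (simp add: pdiff_add algebra_simps)
next
  case (single s c)
  show ?case
  proof (induction q rule: poly_mapping_linear_induct)
    case zero
    then show ?case by (simp add: pdiff_def)
  next
    case (add p q)
    then show ?case by (simp add: pdiff_add algebra_simps)
  next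
    case (single t d)
    let ?e = "Poly_Mapping.single i (1::nat)"
    let ?ls = "Poly_Mapping.lookup s i" and ?lt = "Poly_Mapping.lookup t i"
    have 1: "Poly_Mapping.single (s - ?e + t) (c * of_nat ?ls * d) =
             Poly_Mapping.single (s + t - ?e) (c * d * of_nat ?ls)"
      by (cases "?ls = 0") (simp_all add: single_diff_add[of s i t, simplified] mult_ac)
    have 2: "Poly_Mapping.single (s + (t - ?e)) (c * (d * of_nat ?lt)) =
             Poly_Mapping.single (s + t - ?e) (c * d * of_nat ?lt)"
      by (cases "?lt = 0") (use single_diff_add[of t i s] in \<open>simp_all add: add.commute mult_ac\<close>)
    show ?case
      by (simp only: mult_single pdiff_single 1 2)
         (simp add: lookup_add single_add[symmetric] algebra_simps)
  qed
qed


section \<open>The Weyl algebra and the Weil representation\<close>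

text \<open>
  The free complex algebra on the letters \<open>LX i\<close> and \<open>LD i\<close> with i < N is the monoid algebra
  of words, i.e. the convolution ring of finitely supported functions on words. The Weyl
  algebra is its quotient by the ideal generated by the canonical commutation relations.
\<close>

datatype letter = LX nat | LD nat

datatype word = Word (letters: "letter list")

instantiation word :: monoid_add
begin

definition zero_word :: word where "0 = Word []"

definition plus_word :: "word \<Rightarrow> word \<Rightarrow> word" where "u + v = Word (letters u @ letters v)"

instance
  by standard (auto simp: zero_word_def plus_word_def)

end

type_synonym free_elem = "word \<Rightarrow>\<^sub>0 complex"

definition free_alg :: "nat \<Rightarrow> free_elem ring" where
  "free_alg N = \<lparr>carrier = {a. \<forall>w\<in>Poly_Mapping.keys a. set (letters w) \<subseteq> LX ` {..<N} \<union> LD ` {..<N}},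
     monoid.mult = (*), one = 1, zero = 0, add = (+)\<rparr>"

definition gx :: "nat \<Rightarrow> free_elem" where
  "gx i = Poly_Mapping.single (Word [LX i]) 1"

definition gd :: "nat \<Rightarrow> free_elem" where
  "gd i = Poly_Mapping.single (Word [LD i]) 1"

definition weyl_rels :: "nat \<Rightarrow> free_elem set" where
  "weyl_rels N =
     {gx i * gx j - gx j * gx i | i j. i < N \<and> j < N} \<union>
     {gd i * gd j - gd j * gd i | i j. i < N \<and> j < N} \<union>
     {gd i * gx j - gx j * gd i - (if i = j then 1 else 0) | i j. i < N \<and> j < N}"

definition weyl_ideal :: "nat \<Rightarrow> free_elem set" where
  "weyl_ideal N = Idl\<^bsub>free_alg N\<^esub> (weyl_rels N)"

definition weyl_alg :: "nat \<Rightarrow> free_elem set ring" where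
  "weyl_alg N = free_alg N Quot weyl_ideal N"

definition weyl_class :: "nat \<Rightarrow> free_elem \<Rightarrow> free_elem set" where
  "weyl_class N a = weyl_ideal N +>\<^bsub>free_alg N\<^esub> a"

fun letter_act :: "letter \<Rightarrow> cpoly \<Rightarrow> cpoly" where
  "letter_act (LX i) p = pvar i * p"
| "letter_act (LD i) p = pdiff i p"

definition free_act :: "free_elem \<Rightarrow> cpoly \<Rightarrow> cpoly" where
  "free_act a p = lin_ext (\<lambda>w. foldr letter_act (letters w) p) a"

text \<open>
  All representatives of an element of the Weyl algebra act in the same way, as lemma
  \<open>weyl_act_class\<close> below shows, so the image is a singleton.
\<close>

definition weyl_act :: "free_elem set \<Rightarrow> cpoly \<Rightarrow> cpoly" where
  "weyl_act w p = the_elem ((\<lambda>a. free_act a p) ` w)"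

lemma letter_act_add: "letter_act l (p + q) = letter_act l p + letter_act l q"
  by (cases l) (simp_all add: pdiff_add algebra_simps)

lemma letter_act_scl: "letter_act l (scl c p) = scl c (letter_act l p)"
  by (cases l) (simp_all add: pdiff_scl, simp add: scl_mult mult_ac)

lemma word_act_add: "foldr letter_act ls (p + q) = foldr letter_act ls p + foldr letter_act ls q"
  by (induction ls) (simp_all add: letter_act_add)

lemma word_act_scl: "foldr letter_act ls (scl c p) = scl c (foldr letter_act ls p)"
  by (induction ls) (simp_all add: letter_act_scl)

lemma free_act_add_right: "free_act a (p + q) = free_act a p + free_act a q"
  by (simp add: free_act_def lin_ext_def word_act_add scl_add sum.distrib)

lemma free_act_scl_right: "free_act a (scl c p) = scl c (free_act a p)"
  by (simp add: free_act_def lin_ext_def word_act_scl scl_scl scl_sum mult.commute)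

lemma free_act_zero_right [simp]: "free_act a 0 = 0"
  using free_act_scl_right[of a 0 0] by simp

lemma free_act_add: "free_act (a + b) p = free_act a p + free_act b p"
  by (simp add: free_act_def lin_ext_add)

lemma free_act_diff: "free_act (a - b) p = free_act a p - free_act b p"
  by (simp add: free_act_def lin_ext_diff)

lemma free_act_zero [simp]: "free_act 0 p = 0"
  by (simp add: free_act_def)

lemma free_act_single: "free_act (Poly_Mapping.single w c) p = scl c (foldr letter_act (letters w) p)"
  by (simp add: free_act_def lin_ext_single)

lemma free_act_one: "free_act 1 p = p"
  unfolding single_one[symmetric] free_act_single by (simp add: zero_word_def)

lemma free_act_gens: "free_act (gx i) p = pvar i * p" "free_act (gd i) p = pdiff i p"
  by (simp_all add: gx_def gd_def free_act_single)

lemma free_act_mult: "free_act (a * b) p = free_act a (free_act b p)"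
proof (induction a rule: poly_mapping_linear_induct)
  case (single u c)
  show ?case
  proof (induction b rule: poly_mapping_linear_induct)
    case (single v d)
    show ?case
      by (simp add: mult_single free_act_single plus_word_def word_act_scl scl_scl)
  qed (simp_all add: distrib_left free_act_add free_act_add_right)
qed (simp_all add: distrib_right free_act_add)

lemma pdiff_commute: "pdiff i (pdiff j p) = pdiff j (pdiff i p)"
proof (induction p rule: poly_mapping_linear_induct)
  case (single t c)
  have "t - Poly_Mapping.single j 1 - Poly_Mapping.single i 1 =
        t - Poly_Mapping.single i 1 - Poly_Mapping.single j (1::nat)"
    by (rule poly_mapping_eqI) (simp add: lookup_minus)
  then show ?case
    by (cases "i = j") (simp_all add: pdiff_single lookup_minus lookup_single when_def mult_ac)
qed (simp_all add: pdiff_add, simp add: pdiff_def)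

lemma free_act_weyl_rels: "r \<in> weyl_rels N \<Longrightarrow> free_act r p = 0"
  by (auto simp: weyl_rels_def free_act_diff free_act_mult free_act_gens free_act_one
      pdiff_mult pdiff_pvar pdiff_commute mult_ac)

lemma free_alg_simps:
  "carrier (free_alg N) =
     {a. \<forall>w\<in>Poly_Mapping.keys a. set (letters w) \<subseteq> LX ` {..<N} \<union> LD ` {..<N}}"
  "a \<oplus>\<^bsub>free_alg N\<^esub> b = a + b" "a \<otimes>\<^bsub>free_alg N\<^esub> b = a * b"
  "\<one>\<^bsub>free_alg N\<^esub> = 1" "\<zero>\<^bsub>free_alg N\<^esub> = 0"
  by (simp_all add: free_alg_def)

lemma free_alg_add_closed:
  "a \<in> carrier (free_alg N) \<Longrightarrow> b \<in> carrier (free_alg N) \<Longrightarrow> a + b \<in> carrier (free_alg N)"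
  using keys_add[of a b] unfolding free_alg_simps by blast

lemma free_alg_minus_closed: "a \<in> carrier (free_alg N) \<Longrightarrow> - a \<in> carrier (free_alg N)"
  by (simp add: free_alg_simps keys_minus in_keys_iff)

lemma free_alg_mult_closed:
  assumes "a \<in> carrier (free_alg N)" "b \<in> carrier (free_alg N)"
  shows "a * b \<in> carrier (free_alg N)"
proof -
  have "set (letters w) \<subseteq> LX ` {..<N} \<union> LD ` {..<N}" if w: "w \<in> Poly_Mapping.keys (a * b)" for w
  proof -
    obtain u v where "w = u + v" "u \<in> Poly_Mapping.keys a" "v \<in> Poly_Mapping.keys b"
      using w keys_mult[of a b] by blast
    then show ?thesis using assms unfolding free_alg_simps by (simp add: plus_word_def)
  qed
  then show ?thesis by (simp add: free_alg_simps)
qed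

lemma free_alg_ring: "ring (free_alg N)"
proof (intro ringI abelian_groupI monoidI)
  fix a assume "a \<in> carrier (free_alg N)"
  then show "\<exists>b\<in>carrier (free_alg N). b \<oplus>\<^bsub>free_alg N\<^esub> a = \<zero>\<^bsub>free_alg N\<^esub>"
    by (intro bexI[of _ "- a"]) (simp_all add: free_alg_simps(2-) free_alg_minus_closed)
qed (simp_all add: free_alg_add_closed free_alg_mult_closed free_alg_simps(2-) algebra_simps,
     simp_all add: free_alg_simps zero_word_def)

lemma weyl_rels_closed: "weyl_rels N \<subseteq> carrier (free_alg N)"
proof -
  have g: "gx i \<in> carrier (free_alg N)" "gd i \<in> carrier (free_alg N)" if "i < N" for i
    using that by (auto simp: free_alg_simps gx_def gd_def)
  have d: "a - b \<in> carrier (free_alg N)"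
    if "a \<in> carrier (free_alg N)" "b \<in> carrier (free_alg N)" for a b
    using free_alg_add_closed[OF that(1) free_alg_minus_closed[OF that(2)]] by simp
  have "(1::free_elem) \<in> carrier (free_alg N)" "(0::free_elem) \<in> carrier (free_alg N)"
    by (simp_all add: free_alg_simps zero_word_def)
  then show ?thesis
    unfolding weyl_rels_def by (auto intro!: d free_alg_mult_closed g)
qed

lemma weyl_ideal_ideal: "ideal (weyl_ideal N) (free_alg N)"
  unfolding weyl_ideal_def by (rule ring.genideal_ideal[OF free_alg_ring weyl_rels_closed])

lemma free_act_weyl_ideal:
  assumes "a \<in> weyl_ideal N"
  shows "free_act a p = 0"
proof -
  let ?J = "{a \<in> carrier (free_alg N). \<forall>p. free_act a p = 0}"
  interpret R: ring "free_alg N" by (rule free_alg_ring)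
  have "ideal ?J (free_alg N)"
  proof (rule idealI[OF free_alg_ring])
    show "subgroup ?J (add_monoid (free_alg N))"
    proof (rule R.add.subgroupI)
      show "?J \<noteq> {}" using R.zero_closed by (auto simp: free_alg_simps(5))
      fix a assume a: "a \<in> ?J"
      have "\<ominus>\<^bsub>free_alg N\<^esub> a = - a"
        by (rule R.minus_equality) (use a free_alg_minus_closed in \<open>auto simp: free_alg_simps(2-)\<close>)
      then show "\<ominus>\<^bsub>free_alg N\<^esub> a \<in> ?J"
        using a free_alg_minus_closed free_act_diff[of 0 a] by auto
    qed (use free_alg_add_closed in \<open>auto simp: free_alg_simps(2-) free_act_add\<close>)
  qed (use free_alg_mult_closed in \<open>auto simp: free_alg_simps(2-) free_act_mult\<close>)
  moreover have "weyl_rels N \<subseteq> ?J"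
    using weyl_rels_closed free_act_weyl_rels by auto
  ultimately have "weyl_ideal N \<subseteq> ?J"
    unfolding weyl_ideal_def by (rule R.genideal_minimal)
  then show ?thesis using assms by auto
qed

lemma weyl_act_class:
  "weyl_act (weyl_class N a) p = free_act a p"
proof -
  interpret I: ideal "weyl_ideal N" "free_alg N" by (rule weyl_ideal_ideal)
  have "0 \<in> weyl_ideal N"
    using additive_subgroup.zero_closed[OF I.is_additive_subgroup] by (simp add: free_alg_simps)
  then have "(\<lambda>b. free_act b p) ` weyl_class N a = {free_act a p}"
    by (auto simp: weyl_class_def a_r_coset_def' free_alg_simps(2) free_act_add free_act_weyl_ideal
        image_iff intro!: bexI[of _ 0])
  then show ?thesis by (simp add: weyl_act_def)
qed

definition wx :: "nat \<Rightarrow> nat \<Rightarrow> free_elem set" where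
  "wx N i = weyl_class N (gx i)"

definition wd :: "nat \<Rightarrow> nat \<Rightarrow> free_elem set" where
  "wd N i = weyl_class N (gd i)"

definition wscalar :: "nat \<Rightarrow> complex \<Rightarrow> free_elem set" where
  "wscalar N c = weyl_class N (Poly_Mapping.single 0 c)"

definition alpha :: "nat \<Rightarrow> nat \<Rightarrow> complex mat \<Rightarrow> free_elem set" where
  "alpha m n X = (let N = m * n; W = weyl_alg N in
     \<ominus>\<^bsub>W\<^esub> (\<Oplus>\<^bsub>W\<^esub>i\<in>{..<N}. \<Oplus>\<^bsub>W\<^esub>j\<in>{..<N}.
           wscalar N (2 * B m n X (sbracket m n (xbas m n i) (dbas m n j))) \<otimes>\<^bsub>W\<^esub> (wx N j \<otimes>\<^bsub>W\<^esub> wd N i))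
     \<ominus>\<^bsub>W\<^esub> (\<Oplus>\<^bsub>W\<^esub>i\<in>{..<N}. wscalar N (B m n X (sbracket m n (dbas m n i) (xbas m n i)))))"

lemma free_alg_gens_closed:
  "i < N \<Longrightarrow> gx i \<in> carrier (free_alg N)" "i < N \<Longrightarrow> gd i \<in> carrier (free_alg N)"
  "Poly_Mapping.single 0 c \<in> carrier (free_alg N)"
  by (auto simp: free_alg_simps gx_def gd_def zero_word_def)

lemma free_alg_sum_closed:
  "(\<And>i. i \<in> I \<Longrightarrow> f i \<in> carrier (free_alg N)) \<Longrightarrow> sum f I \<in> carrier (free_alg N)"
proof (induction I rule: infinite_finite_induct)
  case (insert i I)
  then show ?case by (simp add: free_alg_add_closed)
qed (simp_all add: free_alg_simps(1))

lemma free_alg_a_inv: "a \<in> carrier (free_alg N) \<Longrightarrow> \<ominus>\<^bsub>free_alg N\<^esub> a = - a"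
proof -
  interpret R: ring "free_alg N" by (rule free_alg_ring)
  assume "a \<in> carrier (free_alg N)"
  then show "\<ominus>\<^bsub>free_alg N\<^esub> a = - a"
    by (intro R.minus_equality) (auto simp: free_alg_simps(2-) free_alg_minus_closed)
qed

lemma weyl_class_hom: "ring_hom_ring (free_alg N) (weyl_alg N) (weyl_class N)"
  using ideal.rcos_ring_hom_ring[OF weyl_ideal_ideal, of N]
  by (simp add: weyl_alg_def weyl_class_def[abs_def])

lemma weyl_class_sum:
  assumes "finite I" "\<And>i. i \<in> I \<Longrightarrow> f i \<in> carrier (free_alg N)"
  shows "(\<Oplus>\<^bsub>weyl_alg N\<^esub>i\<in>I. weyl_class N (f i)) = weyl_class N (sum f I)"
proof -
  interpret h: ring_hom_ring "free_alg N" "weyl_alg N" "weyl_class N" by (rule weyl_class_hom)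
  show ?thesis
    using assms
  proof (induction I)
    case empty
    then show ?case using h.hom_zero by (simp add: free_alg_simps(5))
  next
    case (insert i I)
    then have "weyl_class N (f i + sum f I) = weyl_class N (f i) \<oplus>\<^bsub>weyl_alg N\<^esub> weyl_class N (sum f I)"
      using h.hom_add[of "f i" "sum f I"] free_alg_sum_closed[of I f N] by (simp add: free_alg_simps(2))
    with insert show ?case by (simp add: h.S.finsum_insert Pi_def)
  qed
qed

lemma alpha_class:
  "alpha m n X = weyl_class (m * n)
     (- (\<Sum>i<m * n. \<Sum>j<m * n. scl (2 * B m n X (sbracket m n (xbas m n i) (dbas m n j))) (gx j * gd i))
      - (\<Sum>i<m * n. scl (B m n X (sbracket m n (dbas m n i) (xbas m n i))) 1))"
proof -
  define N where "N = m * n"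
  interpret h: ring_hom_ring "free_alg N" "weyl_alg N" "weyl_class N" by (rule weyl_class_hom)
  let ?c = "\<lambda>i j. 2 * B m n X (sbracket m n (xbas m n i) (dbas m n j))"
  let ?d = "\<lambda>i. B m n X (sbracket m n (dbas m n i) (xbas m n i))"
  let ?F = "\<lambda>i j. scl (?c i j) (gx j * gd i)" and ?G = "\<lambda>i. scl (?d i) (1 :: free_elem)"
  have g: "gx j * gd i \<in> carrier (free_alg N)" "?F i j \<in> carrier (free_alg N)"
    if "i < N" "j < N" for i j
    using that by (auto simp: scl_mult intro!: free_alg_mult_closed free_alg_gens_closed)
  have G: "?G i = Poly_Mapping.single 0 (?d i)" for i
    by (simp add: scl_mult)
  have t: "wscalar N (?c i j) \<otimes>\<^bsub>weyl_alg N\<^esub> (wx N j \<otimes>\<^bsub>weyl_alg N\<^esub> wd N i) = weyl_class N (?F i j)"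
    if "i < N" "j < N" for i j
  proof -
    have mult: "weyl_class N a \<otimes>\<^bsub>weyl_alg N\<^esub> weyl_class N b = weyl_class N (a * b)"
      if "a \<in> carrier (free_alg N)" "b \<in> carrier (free_alg N)" for a b
      using h.hom_mult[OF that] by (simp only: free_alg_simps(3))
    show ?thesis
      unfolding wscalar_def wx_def wd_def scl_mult
      by (simp only: mult free_alg_gens_closed that g(1)[OF that])
  qed
  have inner: "(\<Oplus>\<^bsub>weyl_alg N\<^esub>j\<in>{..<N}. wscalar N (?c i j) \<otimes>\<^bsub>weyl_alg N\<^esub> (wx N j \<otimes>\<^bsub>weyl_alg N\<^esub> wd N i))
      = weyl_class N (\<Sum>j<N. ?F i j)" if i: "i < N" for i
  proof -
    have "(\<Oplus>\<^bsub>weyl_alg N\<^esub>j\<in>{..<N}. wscalar N (?c i j) \<otimes>\<^bsub>weyl_alg N\<^esub> (wx N j \<otimes>\<^bsub>weyl_alg N\<^esub> wd N i))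
        = (\<Oplus>\<^bsub>weyl_alg N\<^esub>j\<in>{..<N}. weyl_class N (?F i j))"
      by (rule h.S.finsum_cong') (use i g t in auto)
    also have "\<dots> = weyl_class N (\<Sum>j<N. ?F i j)"
      by (rule weyl_class_sum) (use i g in auto)
    finally show ?thesis .
  qed
  have f: "(\<Sum>j<N. ?F i j) \<in> carrier (free_alg N)" if "i < N" for i
    by (rule free_alg_sum_closed) (use that g in auto)
  have "(\<Oplus>\<^bsub>weyl_alg N\<^esub>i\<in>{..<N}. \<Oplus>\<^bsub>weyl_alg N\<^esub>j\<in>{..<N}.
           wscalar N (?c i j) \<otimes>\<^bsub>weyl_alg N\<^esub> (wx N j \<otimes>\<^bsub>weyl_alg N\<^esub> wd N i))
      = (\<Oplus>\<^bsub>weyl_alg N\<^esub>i\<in>{..<N}. weyl_class N (\<Sum>j<N. ?F i j))"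
    by (rule h.S.finsum_cong') (use f inner in auto)
  also have "\<dots> = weyl_class N (\<Sum>i<N. \<Sum>j<N. ?F i j)"
    by (rule weyl_class_sum) (use f in auto)
  finally have 1: "(\<Oplus>\<^bsub>weyl_alg N\<^esub>i\<in>{..<N}. \<Oplus>\<^bsub>weyl_alg N\<^esub>j\<in>{..<N}.
           wscalar N (?c i j) \<otimes>\<^bsub>weyl_alg N\<^esub> (wx N j \<otimes>\<^bsub>weyl_alg N\<^esub> wd N i))
      = weyl_class N (\<Sum>i<N. \<Sum>j<N. ?F i j)" .
  have 2: "(\<Oplus>\<^bsub>weyl_alg N\<^esub>i\<in>{..<N}. wscalar N (?d i)) = weyl_class N (\<Sum>i<N. ?G i)"
    unfolding wscalar_def G by (rule weyl_class_sum) (auto intro: free_alg_gens_closed)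
  have s: "(\<Sum>i<N. \<Sum>j<N. ?F i j) \<in> carrier (free_alg N)" "(\<Sum>i<N. ?G i) \<in> carrier (free_alg N)"
    unfolding G by (auto intro!: free_alg_sum_closed f free_alg_gens_closed)
  have neg: "\<ominus>\<^bsub>weyl_alg N\<^esub> weyl_class N a = weyl_class N (- a)" if "a \<in> carrier (free_alg N)" for a
    using that h.hom_a_inv[OF that] by (simp add: free_alg_a_inv)
  have plus: "weyl_class N a \<oplus>\<^bsub>weyl_alg N\<^esub> weyl_class N b = weyl_class N (a + b)"
    if "a \<in> carrier (free_alg N)" "b \<in> carrier (free_alg N)" for a b
    using h.hom_add[OF that] by (simp add: free_alg_simps(2))
  show ?thesis
    unfolding alpha_def Let_def N_def[symmetric] 1 2 a_minus_def
    by (simp add: neg plus s free_alg_minus_closed)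
qed

definition weil_module :: "nat \<Rightarrow> nat \<Rightarrow> cpoly g0_mod" where
  "weil_module m n = \<lparr>carrier = polys (m * n), monoid.mult = (*), one = 1, zero = 0, add = (+),
     smult = scl, gact = (\<lambda>X p. weyl_act (alpha m n X) p)\<rparr>"


section \<open>The adjoint action on polynomials\<close>

text \<open>The linear embedding of \<open>gminus\<close> into S(\<open>gminus\<close>), sending \<open>xbas a\<close> to the variable x_a.\<close>

definition gminus_poly :: "nat \<Rightarrow> nat \<Rightarrow> complex mat \<Rightarrow> cpoly" where
  "gminus_poly m n Y = (\<Sum>a<m * n. scl (Y $$ (m + a mod n, a div n)) (pvar a))"

lemma gminus_poly_xbas:
  assumes "a < m * n"
  shows "gminus_poly m n (xbas m n a) = pvar a"
proof -
  have lt: "b div n < m" "b mod n < n" if "b < m * n" for b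
  proof -
    have "n > 0" using that by (cases "n = 0") auto
    then show "b div n < m" "b mod n < n"
      using that by (simp_all add: less_mult_imp_div_less)
  qed
  have "scl (xbas m n a $$ (m + b mod n, b div n)) (pvar b) = (if b = a then pvar a else 0)"
    if "b < m * n" for b
  proof -
    have "b = a" if "b mod n = a mod n" "b div n = a div n"
      using that by (metis div_mult_mod_eq)
    then show ?thesis using lt[OF that] by (auto simp: xbas_def E_def)
  qed
  then show ?thesis using assms by (simp add: gminus_poly_def)
qed

text \<open>
  The derivation extending the adjoint action of X on \<open>gminus\<close>; see the two lemmas that follow.
\<close>

definition adj_act :: "nat \<Rightarrow> nat \<Rightarrow> complex mat \<Rightarrow> cpoly \<Rightarrow> cpoly" where
  "adj_act m n X p = (\<Sum>a<m * n. gminus_poly m n (sbracket m n X (xbas m n a)) * pdiff a p)"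

lemma adj_act_derivation: "adj_act m n X (p * q) = adj_act m n X p * q + p * adj_act m n X q"
  by (simp add: adj_act_def pdiff_mult algebra_simps sum.distrib sum_distrib_left)

lemma adj_act_pvar:
  assumes "a < m * n"
  shows "adj_act m n X (pvar a) = gminus_poly m n (sbracket m n X (xbas m n a))"
proof -
  have "adj_act m n X (pvar a) =
      (\<Sum>b<m * n. if b = a then gminus_poly m n (sbracket m n X (xbas m n b)) else 0)"
    unfolding adj_act_def by (rule sum.cong) (auto simp: pdiff_pvar)
  then show ?thesis using assms by simp
qed

definition adj_module :: "nat \<Rightarrow> nat \<Rightarrow> cpoly g0_mod" where
  "adj_module m n = \<lparr>carrier = polys (m * n), monoid.mult = (*), one = 1, zero = 0, add = (+),
     smult = scl, gact = adj_act m n\<rparr>"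


section \<open>The one-dimensional module of weight minus rho_1\<close>

text \<open>Weights are functionals on \<open>h0\<close>, represented by functions that are \<open>undefined\<close> off \<open>h0\<close>.\<close>

definition Delta1p :: "nat \<Rightarrow> nat \<Rightarrow> (complex mat \<Rightarrow> complex) set" where
  "Delta1p m n = {\<beta> \<in> h0 m n \<rightarrow>\<^sub>E UNIV.
     \<exists>v\<in>gplus m n. v \<noteq> 0\<^sub>m (m + n) (m + n) \<and> (\<forall>H\<in>h0 m n. sbracket m n H v = \<beta> H \<cdot>\<^sub>m v)}"

definition rho1 :: "nat \<Rightarrow> nat \<Rightarrow> complex mat \<Rightarrow> complex" where
  "rho1 m n H = 1 / 2 * (\<Sum>\<beta>\<in>Delta1p m n. \<beta> H)"

definition h0_proj :: "nat \<Rightarrow> nat \<Rightarrow> complex mat \<Rightarrow> complex mat" where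
  "h0_proj m n X = mat (m + n) (m + n) (\<lambda>(i, j). if i = j then X $$ (i, j) else 0)"

text \<open>
  The off-diagonal matrix units of \<open>g0\<close> are commutators, hence act by zero on every
  one-dimensional module; so the action factors through the projection to \<open>h0\<close>.
\<close>

definition minus_rho1_module :: "nat \<Rightarrow> nat \<Rightarrow> complex g0_mod" where
  "minus_rho1_module m n = \<lparr>carrier = UNIV, monoid.mult = (*), one = 1, zero = 0, add = (+),
     smult = (*), gact = (\<lambda>X z. - rho1 m n (h0_proj m n X) * z)\<rparr>"


lemma h0_dims:
  assumes "H \<in> h0 m n"
  shows "H \<in> carrier_mat (m + n) (m + n)" "dim_row H = m + n" "dim_col H = m + n"
  using assms by (auto simp: h0_def gl_def)

lemma g0_dims:
  assumes "X \<in> g0 m n"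
  shows "X \<in> carrier_mat (m + n) (m + n)" "dim_row X = m + n" "dim_col X = m + n"
  using assms by (auto simp: g0_def gl_def)

lemma gplus_dims:
  assumes "v \<in> gplus m n"
  shows "v \<in> carrier_mat (m + n) (m + n)" "dim_row v = m + n" "dim_col v = m + n"
  using assms by (auto simp: gplus_def gl_def)

lemma h0_g0: "H \<in> h0 m n \<Longrightarrow> H \<in> g0 m n"
  by (auto simp: h0_def g0_def)

lemma sbracket_even:
  assumes X: "X \<in> g0 m n" and Y: "Y \<in> carrier_mat (m + n) (m + n)"
  shows "sbracket m n X Y = X * Y - Y * X"
proof -
  have e: "even_part m n X = X"
    by (rule eq_matI) (use X in \<open>auto simp: even_part_def g0_def gl_def\<close>)
  have o: "odd_part m n X = 0\<^sub>m (m + n) (m + n)"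
    by (rule eq_matI) (use X in \<open>auto simp: odd_part_def g0_def gl_def\<close>)
  have c: "even_part m n Y \<in> carrier_mat (m + n) (m + n)" "odd_part m n Y \<in> carrier_mat (m + n) (m + n)"
    by (auto simp: even_part_def odd_part_def)
  have "Y = even_part m n Y + odd_part m n Y"
    by (rule eq_matI) (use Y in \<open>auto simp: even_part_def odd_part_def\<close>)
  then have *: "Y * X = even_part m n Y * X + odd_part m n Y * X"
    using add_mult_distrib_mat[OF c(1) c(2) g0_dims(1)[OF X]] by metis
  show ?thesis
    unfolding sbracket_def e o *
    using c g0_dims(1)[OF X] by (intro arg_cong2[of _ _ _ _ "(-)"] refl eq_matI) auto
qed

lemma mat_mult_index:
  assumes "X \<in> carrier_mat d d" "Y \<in> carrier_mat d d" "i < d" "j < d"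
  shows "(X * Y) $$ (i, j) = (\<Sum>k<d. X $$ (i, k) * Y $$ (k, j))"
  using assms by (auto simp: scalar_prod_def lessThan_atLeast0 intro!: sum.cong)

lemma diag_commutator_index:
  assumes H: "H \<in> h0 m n" and Y: "Y \<in> carrier_mat (m + n) (m + n)" and ij: "i < m + n" "j < m + n"
  shows "sbracket m n H Y $$ (i, j) = (H $$ (i, i) - H $$ (j, j)) * Y $$ (i, j)"
proof -
  have z: "H $$ (r, s) = 0" if "r < m + n" "s < m + n" "r \<noteq> s" for r s
    using H that by (auto simp: h0_def)
  have "(\<Sum>k<m + n. H $$ (i, k) * Y $$ (k, j)) = (\<Sum>k<m + n. if k = i then H $$ (i, i) * Y $$ (i, j) else 0)"
    by (rule sum.cong) (use z ij in auto)
  moreover have "(\<Sum>k<m + n. Y $$ (i, k) * H $$ (k, j)) = (\<Sum>k<m + n. if k = j then Y $$ (i, j) * H $$ (j, j) else 0)"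
    by (rule sum.cong) (use z ij in auto)
  ultimately have "(H * Y) $$ (i, j) = H $$ (i, i) * Y $$ (i, j)" "(Y * H) $$ (i, j) = Y $$ (i, j) * H $$ (j, j)"
    using ij by (simp_all add: mat_mult_index[OF h0_dims(1)[OF H] Y] mat_mult_index[OF Y h0_dims(1)[OF H]])
  moreover have "(H * Y - Y * H) $$ (i, j) = (H * Y) $$ (i, j) - (Y * H) $$ (i, j)"
    using ij Y h0_dims[OF H] by (intro index_minus_mat) auto
  ultimately show ?thesis
    unfolding sbracket_even[OF h0_g0[OF H] Y] by (simp add: algebra_simps)
qed

lemma Delta1p_eq:
  "Delta1p m n = (\<lambda>(i, k). restrict (\<lambda>H. H $$ (i, i) - H $$ (k, k)) (h0 m n)) ` ({..<m} \<times> {m..<m + n})"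
    (is "_ = ?w ` _")
proof (intro equalityI subsetI)
  fix \<beta> assume "\<beta> \<in> Delta1p m n"
  then obtain v where b: "\<beta> \<in> h0 m n \<rightarrow>\<^sub>E UNIV" and v: "v \<in> gplus m n" "v \<noteq> 0\<^sub>m (m + n) (m + n)"
    and w: "\<And>H. H \<in> h0 m n \<Longrightarrow> sbracket m n H v = \<beta> H \<cdot>\<^sub>m v"
    by (auto simp: Delta1p_def)
  obtain i k where ik: "i < m + n" "k < m + n" "v $$ (i, k) \<noteq> 0"
    using v(2) gplus_dims[OF v(1)] eq_matI[of "0\<^sub>m (m + n) (m + n)" v] by fastforce
  then have mk: "i < m" "m \<le> k" using v(1) unfolding gplus_def by blast+
  have "\<beta> H = H $$ (i, i) - H $$ (k, k)" if "H \<in> h0 m n" for H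
    using diag_commutator_index[OF that gplus_dims(1)[OF v(1)] ik(1,2)] w[OF that] ik gplus_dims[OF v(1)]
    by simp
  then have "\<beta> = ?w (i, k)"
    using b by (auto simp: PiE_def extensional_def restrict_def fun_eq_iff)
  then show "\<beta> \<in> ?w ` ({..<m} \<times> {m..<m + n})" using mk ik by auto
next
  fix \<beta> assume "\<beta> \<in> ?w ` ({..<m} \<times> {m..<m + n})"
  then obtain i k where ik: "i < m" "m \<le> k" "k < m + n" and b: "\<beta> = ?w (i, k)" by auto
  have v: "E m n i k \<in> gplus m n" using ik by (auto simp: gplus_def E_def gl_def)
  have "E m n i k $$ (i, k) = 1" using ik by (simp add: E_def)
  then have "E m n i k \<noteq> 0\<^sub>m (m + n) (m + n)" using ik by auto
  moreover have "sbracket m n H (E m n i k) = \<beta> H \<cdot>\<^sub>m E m n i k" if H: "H \<in> h0 m n" for H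
  proof (rule eq_matI)
    fix r s assume "r < dim_row (\<beta> H \<cdot>\<^sub>m E m n i k)" "s < dim_col (\<beta> H \<cdot>\<^sub>m E m n i k)"
    then have "r < m + n" "s < m + n" by (auto simp: E_def)
    then show "sbracket m n H (E m n i k) $$ (r, s) = (\<beta> H \<cdot>\<^sub>m E m n i k) $$ (r, s)"
      using diag_commutator_index[OF H gplus_dims(1)[OF v], of r s] H by (simp add: b E_def)
  qed (use gplus_dims[OF v] h0_dims[OF H] in \<open>simp_all add: sbracket_even[OF h0_g0[OF H] gplus_dims(1)[OF v]]\<close>)
  moreover have "\<beta> \<in> h0 m n \<rightarrow>\<^sub>E UNIV" by (auto simp: b)
  ultimately show "\<beta> \<in> Delta1p m n" using v by (auto simp: Delta1p_def)
qed

lemma rho1_eq: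
  assumes "H \<in> h0 m n"
  shows "rho1 m n H = 1 / 2 * (\<Sum>i<m. \<Sum>k\<in>{m..<m + n}. H $$ (i, i) - H $$ (k, k))"
proof -
  let ?w = "\<lambda>(i, k). restrict (\<lambda>H. H $$ (i, i) - H $$ (k, k)) (h0 m n)"
  have "inj_on ?w ({..<m} \<times> {m..<m + n})"
  proof (rule inj_onI)
    fix x y :: "nat \<times> nat"
    assume x: "x \<in> {..<m} \<times> {m..<m + n}" and y: "y \<in> {..<m} \<times> {m..<m + n}" and e: "?w x = ?w y"
    have h: "E m n r r \<in> h0 m n" for r by (auto simp: h0_def E_def gl_def)
    obtain i k i' k' where "x = (i, k)" "y = (i', k')" by (cases x, cases y)
    then show "x = y"
      using fun_cong[OF e, of "E m n i i"] fun_cong[OF e, of "E m n k k"] x y h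
      by (auto simp: E_def split: if_splits)
  qed
  then have "(\<Sum>\<beta>\<in>Delta1p m n. \<beta> H) = (\<Sum>x\<in>{..<m} \<times> {m..<m + n}. ?w x H)"
    unfolding Delta1p_eq by (rule sum.reindex_cong) auto
  also have "\<dots> = (\<Sum>i<m. \<Sum>k\<in>{m..<m + n}. H $$ (i, i) - H $$ (k, k))"
    using assms by (simp add: sum.cartesian_product split_def)
  finally show ?thesis by (simp add: rho1_def)
qed

lemma rho1_h0_proj:
  "rho1 m n (h0_proj m n X) =
     1 / 2 * (of_nat n * (\<Sum>i<m. X $$ (i, i)) - of_nat m * (\<Sum>k\<in>{m..<m + n}. X $$ (k, k)))"
proof -
  have "h0_proj m n X \<in> h0 m n" by (auto simp: h0_proj_def h0_def gl_def)
  then show ?thesis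
    by (simp add: rho1_eq h0_proj_def sum_subtractf sum_distrib_left)
qed

lemma block_trace_commute:
  assumes X: "X \<in> g0 m n" and Y: "Y \<in> g0 m n"
    and I: "I = {..<m} \<or> I = {m..<m + n}"
  shows "(\<Sum>i\<in>I. (X * Y) $$ (i, i)) = (\<Sum>i\<in>I. (Y * X) $$ (i, i))"
proof -
  have *: "(\<Sum>i\<in>I. (X * Y) $$ (i, i)) = (\<Sum>i\<in>I. \<Sum>k\<in>I. X $$ (i, k) * Y $$ (k, i))"
    if X: "X \<in> g0 m n" and Y: "Y \<in> g0 m n" for X Y
  proof (rule sum.cong)
    fix i assume i: "i \<in> I"
    then have lt: "i < m + n" using I by auto
    have "(X * Y) $$ (i, i) = (\<Sum>k<m + n. X $$ (i, k) * Y $$ (k, i))"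
      by (rule mat_mult_index) (use X Y lt g0_dims in auto)
    also have "\<dots> = (\<Sum>k\<in>I. X $$ (i, k) * Y $$ (k, i))"
    proof (rule sum.mono_neutral_right)
      show "\<forall>k\<in>{..<m + n} - I. X $$ (i, k) * Y $$ (k, i) = 0"
        using X i I lt by (auto simp: g0_def)
    qed (use I in auto)
    finally show "(X * Y) $$ (i, i) = (\<Sum>k\<in>I. X $$ (i, k) * Y $$ (k, i))" .
  qed simp
  have "(\<Sum>i\<in>I. (X * Y) $$ (i, i)) = (\<Sum>k\<in>I. \<Sum>i\<in>I. X $$ (i, k) * Y $$ (k, i))"
    unfolding *[OF X Y] by (rule sum.swap)
  then show ?thesis unfolding *[OF Y X] by (simp add: mult.commute)
qed

lemma rho1_bracket:
  assumes X: "X \<in> g0 m n" and Y: "Y \<in> g0 m n"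
  shows "rho1 m n (h0_proj m n (sbracket m n X Y)) = 0"
proof -
  have "(\<Sum>i\<in>I. sbracket m n X Y $$ (i, i)) = 0" if "I = {..<m} \<or> I = {m..<m + n}" for I
  proof -
    have "(\<Sum>i\<in>I. sbracket m n X Y $$ (i, i)) = (\<Sum>i\<in>I. (X * Y) $$ (i, i) - (Y * X) $$ (i, i))"
      unfolding sbracket_even[OF X g0_dims(1)[OF Y]]
      by (rule sum.cong) (use that g0_dims[OF X] g0_dims[OF Y] in auto)
    then show ?thesis using block_trace_commute[OF X Y that] by (simp add: sum_subtractf)
  qed
  then show ?thesis by (simp add: rho1_h0_proj)
qed

lemma complex_ring_cring: "cring complex_ring"
  by unfold_locales
     (auto simp: complex_ring_def Units_def algebra_simps intro: exI[of _ "- x" for x :: complex])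

lemma minus_rho1_module_weight:
  assumes "H \<in> h0 m n"
  shows "gact (minus_rho1_module m n) H z = - rho1 m n H * z"
proof -
  have "h0_proj m n H = H"
    by (rule eq_matI) (use assms in \<open>auto simp: h0_proj_def h0_def gl_def\<close>)
  then show ?thesis by (simp add: minus_rho1_module_def)
qed

lemma minus_rho1_module: "g0_module m n (minus_rho1_module m n)"
proof -
  let ?V = "minus_rho1_module m n"
  have ag: "abelian_group ?V"
    by (rule abelian_groupI)
       (auto simp: minus_rho1_module_def intro: exI[of _ "- x" for x :: complex])
  have mo: "module complex_ring ?V"
    by (rule moduleI[OF complex_ring_cring ag])
       (auto simp: minus_rho1_module_def complex_ring_def algebra_simps)
  have minus: "a \<ominus>\<^bsub>?V\<^esub> b = a - b" for a b
  proof -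
    interpret abelian_group ?V by (rule ag)
    have "\<ominus>\<^bsub>?V\<^esub> b = - b"
      by (rule minus_equality) (simp_all add: minus_rho1_module_def)
    then show ?thesis by (simp add: a_minus_def minus_rho1_module_def)
  qed
  have add: "rho1 m n (h0_proj m n (X + Y)) = rho1 m n (h0_proj m n X) + rho1 m n (h0_proj m n Y)"
    if "X \<in> g0 m n" "Y \<in> g0 m n" for X Y
    using g0_dims[OF that(1)] g0_dims[OF that(2)]
    by (simp add: rho1_h0_proj sum.distrib algebra_simps add_divide_distrib)
  have scale: "rho1 m n (h0_proj m n (c \<cdot>\<^sub>m X)) = c * rho1 m n (h0_proj m n X)"
    if "X \<in> g0 m n" for X c
    using g0_dims[OF that]
    by (simp add: rho1_h0_proj sum_distrib_left[symmetric] algebra_simps)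
  show ?thesis
    unfolding g0_module_def minus
    using mo rho1_bracket add scale
    by (auto simp: minus_rho1_module_def algebra_simps)
qed

lemma minus_rho1_module_unique:
  assumes V: "g0_module m n V" "V = minus_rho1_module m n \<lparr>gact := A\<rparr>"
    and weight: "\<And>H z. H \<in> h0 m n \<Longrightarrow> A H z = - rho1 m n H * z"
    and X: "X \<in> g0 m n"
  shows "A X z = gact (minus_rho1_module m n) X z"
proof -
  interpret module complex_ring V using V(1) by (simp add: g0_module_def)
  have minus: "a \<ominus>\<^bsub>V\<^esub> b = a - b" for a b
  proof -
    have "\<ominus>\<^bsub>V\<^esub> b = - b"
      by (rule M.minus_equality) (simp_all add: minus_rho1_module_def V(2))
    then show ?thesis by (simp add: a_minus_def minus_rho1_module_def V(2))
  qed
  have lin: "A X (c * z) = c * A X z" if "X \<in> g0 m n" for X c z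
    using V(1) that by (simp add: g0_module_def V(2) minus_rho1_module_def)
  have add: "A (X + Y) z = A X z + A Y z" if "X \<in> g0 m n" "Y \<in> g0 m n" for X Y z
    using V(1) that by (simp add: g0_module_def V(2) minus_rho1_module_def)
  have "A (sbracket m n X Y) z = A X (A Y z) - A Y (A X z)" if "X \<in> g0 m n" "Y \<in> g0 m n" for X Y z
    using V(1) that unfolding g0_module_def minus by (simp add: V(2) minus_rho1_module_def)
  then have br: "A (sbracket m n X Y) z = 0" if "X \<in> g0 m n" "Y \<in> g0 m n" for X Y z
    using that lin[of X "A Y z" 1] lin[of Y "A X z" 1] lin[of X z 1] lin[of Y z 1] by simp
  define H where "H = mat (m + n) (m + n) (\<lambda>(i, j). if i = j then of_nat i else (0::complex))"
  define Z where "Z = mat (m + n) (m + n) (\<lambda>(i, j). X $$ (i, j) / (of_nat i - of_nat j))"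
  have H: "H \<in> h0 m n" by (auto simp: H_def h0_def gl_def)
  have Z: "Z \<in> g0 m n" using X by (auto simp: Z_def g0_def gl_def)
  have P: "h0_proj m n X \<in> h0 m n" by (auto simp: h0_proj_def h0_def gl_def)
  have S: "sbracket m n H Z = X - h0_proj m n X"
  proof (rule eq_matI)
    fix i j assume "i < dim_row (X - h0_proj m n X)" "j < dim_col (X - h0_proj m n X)"
    then have "i < m + n" "j < m + n" by (auto simp: h0_proj_def)
    then show "sbracket m n H Z $$ (i, j) = (X - h0_proj m n X) $$ (i, j)"
      using diag_commutator_index[OF H g0_dims(1)[OF Z], of i j] g0_dims[OF X]
      by (auto simp: H_def Z_def h0_proj_def)
  qed (use g0_dims[OF Z] h0_dims[OF H] in
       \<open>simp_all add: sbracket_even[OF h0_g0[OF H] g0_dims(1)[OF Z]] h0_proj_def\<close>)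
  have "X - h0_proj m n X \<in> g0 m n"
    using X by (auto simp: g0_def gl_def h0_proj_def)
  moreover have "h0_proj m n X + (X - h0_proj m n X) = X"
    by (rule eq_matI) (use g0_dims[OF X] in \<open>auto simp: h0_proj_def\<close>)
  ultimately have "A X z = A (h0_proj m n X) z + A (sbracket m n H Z) z"
    using add[OF h0_g0[OF P], of "X - h0_proj m n X" z] by (simp add: S)
  then show ?thesis
    using br[OF h0_g0[OF H] Z] weight[OF P] by (simp add: minus_rho1_module_def)
qed


section \<open>Tensor products\<close>

text \<open>
  The tensor product of V and W is the free vector space on pairs modulo the subspace
  \<open>tensor_null\<close> generated by the bilinearity relations; its elements are cosets.
\<close>

inductive_set tensor_null :: "'v g0_mod \<Rightarrow> 'w g0_mod \<Rightarrow> (('v \<times> 'w) \<Rightarrow>\<^sub>0 complex) set"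
  for V :: "'v g0_mod" and W :: "'w g0_mod" where
  null_zero: "0 \<in> tensor_null V W"
| null_add: "f \<in> tensor_null V W \<Longrightarrow> g \<in> tensor_null V W \<Longrightarrow> f + g \<in> tensor_null V W"
| null_scl: "f \<in> tensor_null V W \<Longrightarrow> scl c f \<in> tensor_null V W"
| rel_add_left: "v \<in> carrier V \<Longrightarrow> v' \<in> carrier V \<Longrightarrow> w \<in> carrier W \<Longrightarrow>
    Poly_Mapping.single (v \<oplus>\<^bsub>V\<^esub> v', w) 1 - Poly_Mapping.single (v, w) 1
      - Poly_Mapping.single (v', w) 1 \<in> tensor_null V W"
| rel_add_right: "v \<in> carrier V \<Longrightarrow> w \<in> carrier W \<Longrightarrow> w' \<in> carrier W \<Longrightarrow>
    Poly_Mapping.single (v, w \<oplus>\<^bsub>W\<^esub> w') 1 - Poly_Mapping.single (v, w) 1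
      - Poly_Mapping.single (v, w') 1 \<in> tensor_null V W"
| rel_smult_left: "v \<in> carrier V \<Longrightarrow> w \<in> carrier W \<Longrightarrow>
    Poly_Mapping.single (c \<odot>\<^bsub>V\<^esub> v, w) 1 - Poly_Mapping.single (v, w) c \<in> tensor_null V W"
| rel_smult_right: "v \<in> carrier V \<Longrightarrow> w \<in> carrier W \<Longrightarrow>
    Poly_Mapping.single (v, c \<odot>\<^bsub>W\<^esub> w) 1 - Poly_Mapping.single (v, w) c \<in> tensor_null V W"

definition tensor_class ::
  "'v g0_mod \<Rightarrow> 'w g0_mod \<Rightarrow> (('v \<times> 'w) \<Rightarrow>\<^sub>0 complex) \<Rightarrow> (('v \<times> 'w) \<Rightarrow>\<^sub>0 complex) set" where
  "tensor_class V W f = {f + r | r. r \<in> tensor_null V W}"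

definition tensor_free_act ::
  "'v g0_mod \<Rightarrow> 'w g0_mod \<Rightarrow> complex mat \<Rightarrow> (('v \<times> 'w) \<Rightarrow>\<^sub>0 complex) \<Rightarrow> (('v \<times> 'w) \<Rightarrow>\<^sub>0 complex)" where
  "tensor_free_act V W X = lin_ext (\<lambda>(v, w).
     Poly_Mapping.single (gact V X v, w) 1 + Poly_Mapping.single (v, gact W X w) 1)"

text \<open>
  The operations are those induced from representatives: for well-defined operations, the
  union of the classes over all representatives is the class of any one of them.
\<close>

definition tensor_module ::
  "'v g0_mod \<Rightarrow> 'w g0_mod \<Rightarrow> (('v \<times> 'w) \<Rightarrow>\<^sub>0 complex) set g0_mod" where
  "tensor_module V W =
    \<lparr>carrier = tensor_class V W ` {f. Poly_Mapping.keys f \<subseteq> carrier V \<times> carrier W},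
     monoid.mult = undefined, one = undefined,
     zero = tensor_class V W 0,
     add = (\<lambda>S T. \<Union>f\<in>S. \<Union>g\<in>T. tensor_class V W (f + g)),
     smult = (\<lambda>c S. \<Union>f\<in>S. tensor_class V W (scl c f)),
     gact = (\<lambda>X S. \<Union>f\<in>S. tensor_class V W (tensor_free_act V W X f))\<rparr>"

end

theory Submission
  imports Defs
begin

text \<open>
  The element \<open>\<alpha>(X)\<close> consists of a vector field with linear coefficients and a constant. The form
  B is invariant, so \<open>B(X, [x_a, \<partial>_b]) = B([X, x_a], \<partial>_b)\<close>, and pairing with \<open>\<partial>_b\<close> reads off the
  coefficient of \<open>x_b\<close> up to the factor \<open>-1/2\<close>: the factor 1/2 is that of B, and the sign is
  the supertrace of a matrix unit in the odd block. Hence \<open>-2 B(X, [x_a, \<partial>_b])\<close> is the coefficient of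
  \<open>x_b\<close> in \<open>[X, x_a]\<close>, and the vector field of \<open>\<alpha>(X)\<close> is exactly the derivation that extends
  \<open>ad X\<close> from \<open>g_-\<close> to the polynomials. The same computation on the diagonal \<open>a = b\<close> shows that the
  constant of \<open>\<alpha>(X)\<close> is half the trace of \<open>ad X\<close> on \<open>g_-\<close>; the weights of \<open>g_-\<close> are the negatives
  of those of \<open>g_+\<close>, so this is \<open>-\<rho>_1\<close> (\<open>alpha_constant\<close>). Together, X acts on the Weil
  representation by \<open>ad X - \<rho>_1(X)\<close> (\<open>weyl_act_alpha\<close>), which is its action on \<open>p \<otimes> 1\<close>.

  So the isomorphism is \<open>p \<mapsto> p \<otimes> 1\<close>. It is a linear bijection because every tensor with values in
  a line can be contracted: the map induced by \<open>v \<otimes> z \<mapsto> z v\<close> is an inverse (\<open>tensor_null_iff\<close>).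
  That the Weil representation is a module follows from the Jacobi identity through
  \<open>adj_act_bracket\<close> together with \<open>\<rho>_1([X, Y]) = 0\<close>, and the module laws for the tensor
  product are then transported along the bijection (\<open>g0_iso_transport\<close>).
\<close>

section \<open>Polynomials in finitely many variables\<close>

lemma polys_zero: "0 \<in> polys N"
  by (simp add: polys_def)

lemma polys_add: "p \<in> polys N \<Longrightarrow> q \<in> polys N \<Longrightarrow> p + q \<in> polys N"
  using keys_add[of p q] unfolding polys_def by blast

lemma polys_scl: "p \<in> polys N \<Longrightarrow> scl c p \<in> polys N"
  using keys_scl[of c p] unfolding polys_def by blast

lemma polys_uminus: "p \<in> polys N \<Longrightarrow> - p \<in> polys N"
  using polys_scl[of p N "-1"] by (simp add: scl_minus)

lemma polys_sum: "(\<And>a. a \<in> A \<Longrightarrow> f a \<in> polys N) \<Longrightarrow> sum f A \<in> polys N"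
  by (induction A rule: infinite_finite_induct) (auto simp: polys_zero polys_add)

lemma polys_mult:
  assumes "p \<in> polys N" "q \<in> polys N"
  shows "p * q \<in> polys N"
proof -
  have "Poly_Mapping.keys t \<subseteq> {..<N}" if t: "t \<in> Poly_Mapping.keys (p * q)" for t
  proof -
    obtain u v where "t = u + v" "u \<in> Poly_Mapping.keys p" "v \<in> Poly_Mapping.keys q"
      using t keys_mult[of p q] by blast
    then show ?thesis using assms keys_add[of u v] unfolding polys_def by blast
  qed
  then show ?thesis by (simp add: polys_def)
qed

lemma polys_pvar: "a < N \<Longrightarrow> pvar a \<in> polys N"
  by (simp add: polys_def pvar_def)

lemma polys_pdiff:
  assumes "p \<in> polys N"
  shows "pdiff a p \<in> polys N"
proof -
  have "Poly_Mapping.keys (t - Poly_Mapping.single a 1) \<subseteq> Poly_Mapping.keys t" for t :: "nat \<Rightarrow>\<^sub>0 nat"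
    by (auto simp: in_keys_iff lookup_minus)
  then show ?thesis
    unfolding pdiff_def lin_ext_def using assms
    by (intro polys_sum polys_scl) (force simp: polys_def)
qed

lemma scl_diff_left: "scl (c - d) p = scl c p - scl d p"
  by (rule poly_mapping_eqI) (simp add: lookup_minus algebra_simps)

lemma scl_mult_right: "scl c (p * q) = p * scl c (q :: cpoly)"
  by (simp add: scl_mult mult_ac)


section \<open>The adjoint action on g_-\<close>

lemma index_div_mod:
  fixes a m n :: nat
  assumes "a < m * n"
  shows "a div n < m" "a mod n < n"
proof -
  have "n > 0" using assms by (cases "n = 0") auto
  then show "a div n < m" "a mod n < n"
    using assms by (simp_all add: less_mult_imp_div_less)
qed

text \<open>
  Translates between the single index a of the variables and the pairs (i, k) of a column i
  and a row k of the lower left block.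
\<close>

lemma sum_div_mod:
  fixes f :: "nat \<Rightarrow> nat \<Rightarrow> 'a::comm_monoid_add"
  shows "(\<Sum>a<m * n. f (a div n) (a mod n)) = (\<Sum>i<m. \<Sum>k<n. f i k)"
proof -
  have *: "i * n + k < m * n" if "i < m" "k < n" for i k
  proof -
    have "i * n + k < Suc i * n" using that by simp
    also have "\<dots> \<le> m * n" using that by (intro mult_le_mono1) simp
    finally show ?thesis .
  qed
  have "(\<Sum>a<m * n. f (a div n) (a mod n)) = (\<Sum>(i, k)\<in>{..<m} \<times> {..<n}. f i k)"
    by (rule sum.reindex_bij_witness[of _ "\<lambda>(i, k). i * n + k" "\<lambda>a. (a div n, a mod n)"])
       (auto simp: index_div_mod *)
  then show ?thesis by (simp add: sum.cartesian_product)
qed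

lemma gminus_dims:
  assumes "Z \<in> gminus m n"
  shows "Z \<in> carrier_mat (m + n) (m + n)" "dim_row Z = m + n" "dim_col Z = m + n"
  using assms by (auto simp: gminus_def gl_def)

lemma xbas_gminus: "a < m * n \<Longrightarrow> xbas m n a \<in> gminus m n"
  using index_div_mod[of a m n] by (auto simp: gminus_def xbas_def E_def gl_def)

lemma dbas_gplus: "a < m * n \<Longrightarrow> dbas m n a \<in> gplus m n"
  using index_div_mod[of a m n] by (auto simp: gplus_def dbas_def E_def gl_def)

lemma g0_add: "X \<in> g0 m n \<Longrightarrow> Y \<in> g0 m n \<Longrightarrow> X + Y \<in> g0 m n"
  by (auto simp: g0_def gl_def)

lemma g0_diff: "X \<in> g0 m n \<Longrightarrow> Y \<in> g0 m n \<Longrightarrow> X - Y \<in> g0 m n"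
  by (auto simp: g0_def gl_def)

lemma g0_smult: "X \<in> g0 m n \<Longrightarrow> c \<cdot>\<^sub>m X \<in> g0 m n"
  by (auto simp: g0_def gl_def)

lemma g0_mult:
  assumes "X \<in> g0 m n" "Y \<in> g0 m n"
  shows "X * Y \<in> g0 m n"
  unfolding g0_def
proof (intro CollectI conjI allI impI)
  show "X * Y \<in> gl m n" using g0_dims[OF assms(1)] g0_dims[OF assms(2)] by (simp add: gl_def)
  fix i j assume ij: "i < m + n" "j < m + n" "(i < m) \<noteq> (j < m)"
  have "X $$ (i, k) * Y $$ (k, j) = 0" if "k < m + n" for k
    using assms ij that by (cases "(i < m) = (k < m)") (auto simp: g0_def)
  then show "(X * Y) $$ (i, j) = 0"
    using ij by (subst mat_mult_index[OF g0_dims(1)[OF assms(1)] g0_dims(1)[OF assms(2)]]) (auto intro: sum.neutral)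
qed

lemma sbracket_g0:
  assumes "X \<in> g0 m n" "Y \<in> g0 m n"
  shows "sbracket m n X Y \<in> g0 m n"
proof -
  have "X * Y - Y * X \<in> g0 m n" using assms by (intro g0_diff g0_mult)
  then show ?thesis by (simp only: sbracket_even[OF assms(1) g0_dims(1)[OF assms(2)]])
qed

lemma sbracket_index:
  assumes X: "X \<in> g0 m n" and Z: "Z \<in> carrier_mat (m + n) (m + n)" and "r < m + n" "s < m + n"
  shows "sbracket m n X Z $$ (r, s) = (\<Sum>k<m + n. X $$ (r, k) * Z $$ (k, s) - Z $$ (r, k) * X $$ (k, s))"
proof -
  have "sbracket m n X Z $$ (r, s) = (X * Z) $$ (r, s) - (Z * X) $$ (r, s)"
    unfolding sbracket_even[OF X Z] using assms g0_dims[OF X] by (intro index_minus_mat) auto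
  then show ?thesis
    using assms by (simp add: mat_mult_index[OF g0_dims(1)[OF X] Z]
        mat_mult_index[OF Z g0_dims(1)[OF X]] sum_subtractf)
qed

lemma sbracket_gminus:
  assumes X: "X \<in> g0 m n" and Z: "Z \<in> gminus m n"
  shows "sbracket m n X Z \<in> gminus m n"
  unfolding gminus_def
proof (intro CollectI conjI allI impI)
  show "sbracket m n X Z \<in> gl m n"
    using g0_dims[OF X] gminus_dims[OF Z]
    by (auto simp: sbracket_even[OF X gminus_dims(1)[OF Z]] gl_def)
  fix r s assume rs: "r < m + n" "s < m + n" "\<not> (s < m \<and> m \<le> r)"
  have "X $$ (r, k) * Z $$ (k, s) - Z $$ (r, k) * X $$ (k, s) = 0" if "k < m + n" for k
  proof -
    have "X $$ (r, k) = 0 \<or> Z $$ (k, s) = 0"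
      using X Z rs that unfolding g0_def gminus_def mem_Collect_eq by (metis linorder_not_le)
    moreover have "Z $$ (r, k) = 0 \<or> X $$ (k, s) = 0"
      using X Z rs that unfolding g0_def gminus_def mem_Collect_eq by (metis linorder_not_le)
    ultimately show ?thesis by auto
  qed
  then show "sbracket m n X Z $$ (r, s) = 0"
    using rs by (simp add: sbracket_index[OF X gminus_dims(1)[OF Z]])
qed

lemma gminus_expand:
  assumes Z: "Z \<in> gminus m n" and r: "r < m + n" and s: "s < m + n"
  shows "Z $$ (r, s) = (\<Sum>a<m * n. Z $$ (m + a mod n, a div n) * xbas m n a $$ (r, s))"
proof -
  have "(\<Sum>a<m * n. Z $$ (m + a mod n, a div n) * xbas m n a $$ (r, s))
      = (\<Sum>i<m. \<Sum>k<n. Z $$ (m + k, i) * (if r = m + k \<and> s = i then 1 else 0))"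
    unfolding sum_div_mod[symmetric] using r s by (intro sum.cong) (auto simp: xbas_def E_def)
  also have "\<dots> = (\<Sum>i<m. if s = i then \<Sum>k<n. if r = m + k then Z $$ (r, s) else 0 else 0)"
    by (intro sum.cong refl) (auto intro!: sum.cong sum.neutral)
  also have "\<dots> = (if s < m then \<Sum>k<n. if r = m + k then Z $$ (r, s) else 0 else 0)"
    by simp
  also have "\<dots> = Z $$ (r, s)"
  proof (cases "s < m \<and> m \<le> r")
    case True
    then have "(\<Sum>k<n. if r = m + k then Z $$ (r, s) else 0) = (\<Sum>k<n. if k = r - m then Z $$ (r, s) else 0)"
      by (intro sum.cong) auto
    moreover have "r - m < n" using True r by auto
    ultimately show ?thesis using True by simp
  next
    case False
    then have "Z $$ (r, s) = 0" using Z r s by (auto simp: gminus_def)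
    then show ?thesis by (auto intro: sum.neutral)
  qed
  finally show ?thesis by simp
qed

text \<open>
  Linearity of \<open>ad X\<close> on \<open>g_-\<close>, in the form of the expansion of its argument in the basis \<open>xbas\<close>.
\<close>

lemma sbracket_gminus_expand:
  assumes X: "X \<in> g0 m n" and Z: "Z \<in> gminus m n" and r: "r < m + n" and s: "s < m + n"
  shows "sbracket m n X Z $$ (r, s) =
    (\<Sum>a<m * n. Z $$ (m + a mod n, a div n) * sbracket m n X (xbas m n a) $$ (r, s))"
proof -
  let ?z = "\<lambda>a. Z $$ (m + a mod n, a div n)" and ?x = "xbas m n"
  have "X $$ (r, k) * Z $$ (k, s) - Z $$ (r, k) * X $$ (k, s)
      = (\<Sum>a<m * n. ?z a * (X $$ (r, k) * ?x a $$ (k, s) - ?x a $$ (r, k) * X $$ (k, s)))"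
    if "k < m + n" for k
    using that r s
    by (simp add: gminus_expand[OF Z, of k s] gminus_expand[OF Z, of r k] sum_distrib_left sum_distrib_right
        sum_subtractf[symmetric] algebra_simps)
  then have "sbracket m n X Z $$ (r, s) = (\<Sum>k<m + n. \<Sum>a<m * n.
      ?z a * (X $$ (r, k) * ?x a $$ (k, s) - ?x a $$ (r, k) * X $$ (k, s)))"
    using r s by (simp add: sbracket_index[OF X gminus_dims(1)[OF Z]])
  also have "\<dots> = (\<Sum>a<m * n. ?z a *
      (\<Sum>k<m + n. X $$ (r, k) * ?x a $$ (k, s) - ?x a $$ (r, k) * X $$ (k, s)))"
    by (subst sum.swap) (simp add: sum_distrib_left)
  also have "\<dots> = (\<Sum>a<m * n. ?z a * sbracket m n X (?x a) $$ (r, s))"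
    using r s by (intro sum.cong) (simp_all add: sbracket_index[OF X gminus_dims(1)[OF xbas_gminus]])
  finally show ?thesis .
qed

lemma jacobi_gminus:
  assumes X: "X \<in> g0 m n" and Y: "Y \<in> g0 m n" and Z: "Z \<in> gminus m n"
  shows "sbracket m n (sbracket m n X Y) Z = sbracket m n X (sbracket m n Y Z) - sbracket m n Y (sbracket m n X Z)"
proof -
  note d = g0_dims(1)[OF X] g0_dims(1)[OF Y] gminus_dims(1)[OF Z]
  have XY: "sbracket m n X Y = X * Y - Y * X" by (rule sbracket_even[OF X d(2)])
  have XZ: "sbracket m n X Z = X * Z - Z * X" by (rule sbracket_even[OF X d(3)])
  have YZ: "sbracket m n Y Z = Y * Z - Z * Y" by (rule sbracket_even[OF Y d(3)])
  have XYZ: "sbracket m n (sbracket m n X Y) Z = (X * Y - Y * X) * Z - Z * (X * Y - Y * X)"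
    using sbracket_even[OF sbracket_g0[OF X Y] d(3)] by (simp only: XY)
  have X_YZ: "sbracket m n X (sbracket m n Y Z) = X * (Y * Z - Z * Y) - (Y * Z - Z * Y) * X"
    unfolding YZ using d by (intro sbracket_even[OF X]) auto
  have Y_XZ: "sbracket m n Y (sbracket m n X Z) = Y * (X * Z - Z * X) - (X * Z - Z * X) * Y"
    unfolding XZ using d by (intro sbracket_even[OF Y]) auto
  note dist = minus_mult_distrib_mat[of _ "m + n" "m + n" _ _ "m + n"]
    mult_minus_distrib_mat[of _ "m + n" "m + n" _ "m + n"]
    assoc_mult_mat[of _ "m + n" "m + n" _ "m + n" _ "m + n"]
    mult_carrier_mat[of _ "m + n" "m + n" _ "m + n"]
  have "(X * Y - Y * X) * Z - Z * (X * Y - Y * X) =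
      (X * (Y * Z) - Y * (X * Z)) - (Z * (X * Y) - Z * (Y * X))"
    "X * (Y * Z - Z * Y) - (Y * Z - Z * Y) * X =
      (X * (Y * Z) - X * (Z * Y)) - (Y * (Z * X) - Z * (Y * X))"
    "Y * (X * Z - Z * X) - (X * Z - Z * X) * Y =
      (Y * (X * Z) - Y * (Z * X)) - (X * (Z * Y) - Z * (X * Y))"
    using d by (simp_all add: dist)
  note expand = this
  \<comment> \<open>Entrywise, with the entries of triple products kept as atoms, the identity is linear.\<close>
  show ?thesis
    unfolding XYZ X_YZ Y_XZ expand
    by (rule eq_matI) (simp_all add: g0_dims[OF X] g0_dims[OF Y] gminus_dims[OF Z] del: index_mult_mat(1))
qed

lemma gminus_poly_diff:
  assumes "Y \<in> gminus m n" "Z \<in> gminus m n"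
  shows "gminus_poly m n (Y - Z) = gminus_poly m n Y - gminus_poly m n Z"
  unfolding gminus_poly_def sum_subtractf[symmetric]
proof (rule sum.cong)
  fix a assume "a \<in> {..<m * n}"
  then have "m + a mod n < m + n" "a div n < m + n" using index_div_mod[of a m n] by auto
  then show "scl ((Y - Z) $$ (m + a mod n, a div n)) (pvar a) =
      scl (Y $$ (m + a mod n, a div n)) (pvar a) - scl (Z $$ (m + a mod n, a div n)) (pvar a)"
    using assms[THEN gminus_dims(2)] assms[THEN gminus_dims(3)]
    by (simp add: scl_diff_left)
qed simp

lemma gminus_poly_polys: "gminus_poly m n Z \<in> polys (m * n)"
  unfolding gminus_poly_def by (intro polys_sum polys_scl polys_pvar) auto

lemma adj_act_polys: "p \<in> polys (m * n) \<Longrightarrow> adj_act m n X p \<in> polys (m * n)"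
  unfolding adj_act_def by (intro polys_sum polys_mult gminus_poly_polys polys_pdiff)

lemma adj_act_plus: "adj_act m n X (p + q) = adj_act m n X p + adj_act m n X q"
  by (simp add: adj_act_def pdiff_add algebra_simps sum.distrib)

lemma adj_act_scl: "adj_act m n X (scl c p) = scl c (adj_act m n X p)"
  by (simp add: adj_act_def pdiff_scl scl_sum scl_mult_right)

lemma adj_act_sum: "adj_act m n X (sum f A) = (\<Sum>a\<in>A. adj_act m n X (f a))"
proof (induction A rule: infinite_finite_induct)
  have "adj_act m n X 0 = 0" using adj_act_scl[of m n X 0 0] by simp
  then show "adj_act m n X (sum f A) = (\<Sum>a\<in>A. adj_act m n X (f a))" if "infinite A" for A
    using that by simp
  show "adj_act m n X (sum f {}) = (\<Sum>a\<in>{}. adj_act m n X (f a))"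
    using \<open>adj_act m n X 0 = 0\<close> by simp
qed (simp add: adj_act_plus)

text \<open>
  On linear polynomials the derivation restricts to \<open>ad X\<close>; both sides are linear in Z, and on the
  basis this is the definition of the derivation.
\<close>

lemma adj_act_gminus_poly:
  assumes X: "X \<in> g0 m n" and Z: "Z \<in> gminus m n"
  shows "adj_act m n X (gminus_poly m n Z) = gminus_poly m n (sbracket m n X Z)"
proof -
  let ?z = "\<lambda>a. Z $$ (m + a mod n, a div n)"
  let ?L = "\<lambda>a b. sbracket m n X (xbas m n a) $$ (m + b mod n, b div n)"
  have "adj_act m n X (gminus_poly m n Z) = (\<Sum>a<m * n. scl (?z a) (\<Sum>b<m * n. scl (?L a b) (pvar b)))"
    unfolding gminus_poly_def[of m n Z] adj_act_sum adj_act_scl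
    by (intro sum.cong) (auto simp: adj_act_pvar, simp add: gminus_poly_def)
  also have "\<dots> = (\<Sum>b<m * n. \<Sum>a<m * n. scl (?z a * ?L a b) (pvar b))"
    by (subst sum.swap) (simp add: scl_sum scl_scl)
  also have "\<dots> = (\<Sum>b<m * n. scl (\<Sum>a<m * n. ?z a * ?L a b) (pvar b))"
  proof -
    have "(\<Sum>a\<in>A. scl (f a) p) = scl (sum f A) p" for f :: "nat \<Rightarrow> complex" and A and p :: cpoly
      by (induction A rule: infinite_finite_induct) (simp_all add: scl_add_left)
    then show ?thesis by simp
  qed
  also have "\<dots> = gminus_poly m n (sbracket m n X Z)"
    unfolding gminus_poly_def
  proof (rule sum.cong)
    fix b assume "b \<in> {..<m * n}"
    then have "m + b mod n < m + n" "b div n < m + n" using index_div_mod[of b m n] by auto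
    then show "scl (\<Sum>a<m * n. ?z a * ?L a b) (pvar b) = scl (sbracket m n X Z $$ (m + b mod n, b div n)) (pvar b)"
      by (simp only: sbracket_gminus_expand[OF X Z])
  qed simp
  finally show ?thesis .
qed

text \<open>
  The operators are first-order, \<open>\<Sum>_a [X, x_a] \<partial>_a\<close>. In the commutator of two of them the
  second derivatives cancel, and what remains has coefficients \<open>[X, [Y, x_a]] - [Y, [X, x_a]]\<close>,
  to which the Jacobi identity applies.
\<close>

lemma adj_act_bracket:
  assumes X: "X \<in> g0 m n" and Y: "Y \<in> g0 m n"
  shows "adj_act m n (sbracket m n X Y) p = adj_act m n X (adj_act m n Y p) - adj_act m n Y (adj_act m n X p)"
proof -
  let ?L = "\<lambda>X a. gminus_poly m n (sbracket m n X (xbas m n a))"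
  let ?S = "\<lambda>X Y. \<Sum>a<m * n. \<Sum>b<m * n. ?L Y a * (?L X b * pdiff b (pdiff a p))"
  have *: "adj_act m n X (adj_act m n Y p) = (\<Sum>a<m * n. adj_act m n X (?L Y a) * pdiff a p) + ?S X Y" for X Y
  proof -
    have "adj_act m n X (adj_act m n Y p) =
        (\<Sum>a<m * n. adj_act m n X (?L Y a) * pdiff a p + ?L Y a * adj_act m n X (pdiff a p))"
      unfolding adj_act_def[of m n Y p] adj_act_sum adj_act_derivation ..
    then show ?thesis by (simp add: sum.distrib adj_act_def[of m n X "pdiff _ p"] sum_distrib_left)
  qed
  \<comment> \<open>The second-order part of a product of two vector fields does not depend on their order.\<close>
  have sym: "?S X Y = ?S Y X"
    by (subst sum.swap) (simp add: pdiff_commute[of _ _ p] mult_ac)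
  have "adj_act m n X (adj_act m n Y p) - adj_act m n Y (adj_act m n X p)
      = (\<Sum>a<m * n. (adj_act m n X (?L Y a) - adj_act m n Y (?L X a)) * pdiff a p)"
    unfolding *[of X Y] *[of Y X] sym by (simp add: sum_subtractf left_diff_distrib)
  also have "\<dots> = adj_act m n (sbracket m n X Y) p"
    unfolding adj_act_def[of m n "sbracket m n X Y" p]
  proof (rule sum.cong)
    fix a assume "a \<in> {..<m * n}"
    then have x: "xbas m n a \<in> gminus m n" by (simp add: xbas_gminus)
    have "adj_act m n X (?L Y a) - adj_act m n Y (?L X a) = ?L (sbracket m n X Y) a"
      by (simp add: adj_act_gminus_poly sbracket_gminus gminus_poly_diff jacobi_gminus X Y x)
    then show "(adj_act m n X (?L Y a) - adj_act m n Y (?L X a)) * pdiff a p = ?L (sbracket m n X Y) a * pdiff a p"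
      by simp
  qed simp
  finally show ?thesis by simp
qed

lemma adj_act_linear_left:
  assumes X: "X \<in> g0 m n" and Y: "Y \<in> g0 m n"
  shows "adj_act m n (X + Y) p = adj_act m n X p + adj_act m n Y p"
    and "adj_act m n (c \<cdot>\<^sub>m X) p = scl c (adj_act m n X p)"
proof -
  have "gminus_poly m n (sbracket m n (X + Y) (xbas m n a)) =
      gminus_poly m n (sbracket m n X (xbas m n a)) + gminus_poly m n (sbracket m n Y (xbas m n a))"
   and "gminus_poly m n (sbracket m n (c \<cdot>\<^sub>m X) (xbas m n a)) =
      scl c (gminus_poly m n (sbracket m n X (xbas m n a)))" if a: "a < m * n" for a
  proof -
    note x = gminus_dims(1)[OF xbas_gminus[OF a]]
    have l: "m + b mod n < m + n" "b div n < m + n" if "b < m * n" for b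
      using index_div_mod[OF that] by auto
    have "sbracket m n (X + Y) (xbas m n a) $$ (r, s) =
       sbracket m n X (xbas m n a) $$ (r, s) + sbracket m n Y (xbas m n a) $$ (r, s)"
      and "sbracket m n (c \<cdot>\<^sub>m X) (xbas m n a) $$ (r, s) = c * sbracket m n X (xbas m n a) $$ (r, s)"
      if "r < m + n" "s < m + n" for r s
      using that g0_dims[OF X] g0_dims[OF Y]
      by (simp_all add: sbracket_index x X Y g0_add g0_smult sum.distrib[symmetric] sum_distrib_left algebra_simps)
    then show "gminus_poly m n (sbracket m n (X + Y) (xbas m n a)) =
      gminus_poly m n (sbracket m n X (xbas m n a)) + gminus_poly m n (sbracket m n Y (xbas m n a))"
     and "gminus_poly m n (sbracket m n (c \<cdot>\<^sub>m X) (xbas m n a)) =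
      scl c (gminus_poly m n (sbracket m n X (xbas m n a)))"
      using l by (simp_all add: gminus_poly_def scl_add_left scl_sum scl_scl sum.distrib[symmetric])
  qed
  then show "adj_act m n (X + Y) p = adj_act m n X p + adj_act m n Y p"
    and "adj_act m n (c \<cdot>\<^sub>m X) p = scl c (adj_act m n X p)"
    by (simp_all add: adj_act_def scl_sum scl_mult_left sum.distrib[symmetric] distrib_right)
qed


section \<open>The Weil action\<close>

text \<open>
  Both sides sum the same products of entries over the two off-diagonal blocks, but on the
  left the diagonal entries lie in the even block and on the right in the odd one.
\<close>

lemma str_odd:
  assumes A: "A \<in> gplus m n" and Z: "Z \<in> gminus m n"
  shows "str m n (A * Z) = - str m n (Z * A)"
proof -
  note d = gplus_dims(1)[OF A] gminus_dims(1)[OF Z]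
  have "str m n (A * Z) = (\<Sum>i<m. \<Sum>k<m + n. A $$ (i, k) * Z $$ (k, i))
       - (\<Sum>j\<in>{m..<m + n}. \<Sum>k<m + n. A $$ (j, k) * Z $$ (k, j))"
    unfolding str_def by (simp add: mat_mult_index[OF d])
  also have "(\<Sum>j\<in>{m..<m + n}. \<Sum>k<m + n. A $$ (j, k) * Z $$ (k, j)) = 0"
    using A by (intro sum.neutral ballI) (auto simp: gplus_def)
  also have "(\<Sum>i<m. \<Sum>k<m + n. A $$ (i, k) * Z $$ (k, i)) = (\<Sum>i<m. \<Sum>k\<in>{m..<m + n}. A $$ (i, k) * Z $$ (k, i))"
    using A by (intro sum.cong refl sum.mono_neutral_right) (auto simp: gplus_def)
  finally have 1: "str m n (A * Z) = (\<Sum>i<m. \<Sum>k\<in>{m..<m + n}. A $$ (i, k) * Z $$ (k, i))" by simp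
  have "str m n (Z * A) = (\<Sum>i<m. \<Sum>k<m + n. Z $$ (i, k) * A $$ (k, i))
       - (\<Sum>j\<in>{m..<m + n}. \<Sum>k<m + n. Z $$ (j, k) * A $$ (k, j))"
    unfolding str_def by (simp add: mat_mult_index[OF d(2,1)])
  also have "(\<Sum>i<m. \<Sum>k<m + n. Z $$ (i, k) * A $$ (k, i)) = 0"
    using Z by (intro sum.neutral ballI) (auto simp: gminus_def)
  also have "(\<Sum>j\<in>{m..<m + n}. \<Sum>k<m + n. Z $$ (j, k) * A $$ (k, j)) = (\<Sum>j\<in>{m..<m + n}. \<Sum>k<m. Z $$ (j, k) * A $$ (k, j))"
    using A by (intro sum.cong refl sum.mono_neutral_right) (auto simp: gplus_def)
  also have "\<dots> = (\<Sum>k<m. \<Sum>j\<in>{m..<m + n}. Z $$ (j, k) * A $$ (k, j))" by (rule sum.swap)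
  finally show ?thesis using 1 by (simp add: mult.commute)
qed

lemma g0_mult_gplus:
  assumes X: "X \<in> g0 m n" and A: "A \<in> gplus m n"
  shows "X * A \<in> gplus m n"
  unfolding gplus_def
proof (intro CollectI conjI allI impI)
  show "X * A \<in> gl m n" using g0_dims[OF X] gplus_dims[OF A] by (simp add: gl_def)
  fix r s assume rs: "r < m + n" "s < m + n" "\<not> (r < m \<and> m \<le> s)"
  have "X $$ (r, k) * A $$ (k, s) = 0" if "k < m + n" for k
    using X A rs that unfolding g0_def gplus_def mem_Collect_eq mult_eq_0_iff by (metis linorder_not_le)
  then show "(X * A) $$ (r, s) = 0"
    using rs by (subst mat_mult_index[OF g0_dims(1)[OF X] gplus_dims(1)[OF A]]) (auto intro: sum.neutral)
qed

lemma sbracket_odd: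
  assumes A: "A \<in> gplus m n" and Z: "Z \<in> gminus m n"
  shows "sbracket m n Z A = Z * A + A * Z" and "sbracket m n A Z = Z * A + A * Z"
proof -
  note d = gplus_dims[OF A] gminus_dims[OF Z]
  \<comment> \<open>Of the corrections in the bracket only the product of the odd parts survives; its two signs cancel.\<close>
  have p: "even_part m n A = 0\<^sub>m (m + n) (m + n)" "even_part m n Z = 0\<^sub>m (m + n) (m + n)"
          "odd_part m n A = A" "odd_part m n Z = Z"
    using A Z d by (auto simp: even_part_def odd_part_def gplus_def gminus_def intro!: eq_matI)
  show "sbracket m n Z A = Z * A + A * Z" "sbracket m n A Z = Z * A + A * Z"
    unfolding sbracket_def p
    by (rule eq_matI; use d in \<open>simp del: index_mult_mat(1)\<close>)+
qed

lemma str_add: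
  assumes "A \<in> carrier_mat (m + n) (m + n)" "C \<in> carrier_mat (m + n) (m + n)"
  shows "str m n (A + C) = str m n A + str m n C" "str m n (A - C) = str m n A - str m n C"
  using assms by (auto simp: str_def sum.distrib sum_subtractf)

text \<open>
  Expanding \<open>[Z, A] = Z A + A Z\<close>, the term \<open>str (X A Z)\<close> turns into \<open>- str (Z X A)\<close> because
  \<open>X A\<close> and Z are odd; this is what makes the bracket on the right a commutator.
\<close>

lemma B_invariant:
  assumes X: "X \<in> g0 m n" and A: "A \<in> gplus m n" and Z: "Z \<in> gminus m n"
  shows "B m n X (sbracket m n Z A) = B m n (sbracket m n X Z) A"
proof -
  note d = g0_dims(1)[OF X] gplus_dims(1)[OF A] gminus_dims(1)[OF Z]
  have "str m n (X * sbracket m n Z A) = str m n (X * (Z * A)) + str m n (X * (A * Z))"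
    unfolding sbracket_odd[OF A Z] using d
    by (subst mult_add_distrib_mat[of _ "m + n" "m + n" _ "m + n"]) (auto intro!: str_add)
  also have "X * (A * Z) = (X * A) * Z"
    using d by (simp add: assoc_mult_mat[of _ "m + n" "m + n" _ "m + n" _ "m + n"])
  also have "str m n \<dots> = - str m n (Z * (X * A))"
    by (rule str_odd[OF g0_mult_gplus[OF X A] Z])
  also have "str m n (X * (Z * A)) + - str m n (Z * (X * A)) = str m n (sbracket m n X Z * A)"
    unfolding sbracket_even[OF X d(3)] using d
    by (subst minus_mult_distrib_mat[of _ "m + n" "m + n" _ _ "m + n"])
       (auto simp: str_add assoc_mult_mat[of _ "m + n" "m + n" _ "m + n" _ "m + n"])
  finally show ?thesis by (simp add: B_def)
qed

lemma B_dbas: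
  assumes Z: "Z \<in> gminus m n" and b: "b < m * n"
  shows "B m n Z (dbas m n b) = - (1 / 2) * Z $$ (m + b mod n, b div n)"
proof -
  note l = index_div_mod[OF b]
  note d = gplus_dims(1)[OF dbas_gplus[OF b]] gminus_dims(1)[OF Z]
  have p: "(Z * dbas m n b) $$ (r, r) = (if r = m + b mod n then Z $$ (r, b div n) else 0)" if "r < m + n" for r
  proof -
    have "(Z * dbas m n b) $$ (r, r) = (\<Sum>k<m + n. if k = b div n then if r = m + b mod n then Z $$ (r, b div n) else 0 else 0)"
      unfolding mat_mult_index[OF d(2,1) that that]
      by (rule sum.cong) (use that in \<open>auto simp: dbas_def E_def\<close>)
    then show ?thesis using l by simp
  qed
  have "(\<Sum>i<m. (Z * dbas m n b) $$ (i, i)) = 0"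
    by (intro sum.neutral) (auto simp: p)
  moreover have "(\<Sum>j\<in>{m..<m + n}. (Z * dbas m n b) $$ (j, j)) =
      (\<Sum>j\<in>{m..<m + n}. if j = m + b mod n then Z $$ (m + b mod n, b div n) else 0)"
    by (intro sum.cong) (auto simp: p)
  ultimately have "str m n (Z * dbas m n b) = - Z $$ (m + b mod n, b div n)"
    using l by (simp add: str_def)
  then show ?thesis by (simp add: B_def)
qed

text \<open>
  Moving the bracket onto X turns the form into a coordinate of \<open>[X, x_a]\<close>. The sign on the right
  cancels the one in front of the double sum in \<open>\<alpha>(X)\<close>, whose quadratic part is thus \<open>ad X\<close> on \<open>g_-\<close>.
\<close>

lemma B_coefficient:
  assumes X: "X \<in> g0 m n" and a: "a < m * n" and b: "b < m * n"
  shows "2 * B m n X (sbracket m n (xbas m n a) (dbas m n b)) =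
    - sbracket m n X (xbas m n a) $$ (m + b mod n, b div n)"
  using B_invariant[OF X dbas_gplus[OF b] xbas_gminus[OF a]]
    B_dbas[OF sbracket_gminus[OF X xbas_gminus[OF a]] b] by simp

lemma sbracket_xbas_diagonal:
  assumes X: "X \<in> g0 m n" and a: "a < m * n"
  shows "sbracket m n X (xbas m n a) $$ (m + a mod n, a div n) =
    X $$ (m + a mod n, m + a mod n) - X $$ (a div n, a div n)"
proof -
  note l = index_div_mod[OF a]
  have l': "m + a mod n < m + n" "a div n < m + n" using l by auto
  have "sbracket m n X (xbas m n a) $$ (m + a mod n, a div n) =
     (\<Sum>k<m + n. (if k = m + a mod n then X $$ (m + a mod n, k) else 0)
        - (if k = a div n then X $$ (k, a div n) else 0))"
    unfolding sbracket_index[OF X gminus_dims(1)[OF xbas_gminus[OF a]] l']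
    by (rule sum.cong) (use l' in \<open>auto simp: xbas_def E_def\<close>)
  then show ?thesis using l by (simp add: sum_subtractf)
qed

text \<open>
  The bracket of odd elements is symmetric, so each summand is minus half a diagonal entry
  of the matrix of \<open>ad X\<close>, and the sum is minus half the trace of \<open>ad X\<close> on \<open>g_-\<close>.
\<close>

lemma alpha_constant:
  assumes X: "X \<in> g0 m n"
  shows "(\<Sum>a<m * n. B m n X (sbracket m n (dbas m n a) (xbas m n a))) = rho1 m n (h0_proj m n X)"
proof -
  have "(\<Sum>a<m * n. B m n X (sbracket m n (dbas m n a) (xbas m n a))) =
      (\<Sum>a<m * n. 1 / 2 * (X $$ (a div n, a div n) - X $$ (m + a mod n, m + a mod n)))"
  proof (rule sum.cong)
    fix a assume "a \<in> {..<m * n}"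
    then have a: "a < m * n" by simp
    have "sbracket m n (dbas m n a) (xbas m n a) = sbracket m n (xbas m n a) (dbas m n a)"
      using sbracket_odd[OF dbas_gplus[OF a] xbas_gminus[OF a]] by simp
    then show "B m n X (sbracket m n (dbas m n a) (xbas m n a)) =
        1 / 2 * (X $$ (a div n, a div n) - X $$ (m + a mod n, m + a mod n))"
      using B_coefficient[OF X a a] sbracket_xbas_diagonal[OF X a] by (simp add: field_simps)
  qed simp
  also have "\<dots> = 1 / 2 * (\<Sum>i<m. \<Sum>k<n. X $$ (i, i) - X $$ (m + k, m + k))"
    using sum_div_mod[of "\<lambda>i k. 1 / 2 * (X $$ (i, i) - X $$ (m + k, m + k))" n m]
    by (simp add: sum_distrib_left)
  also have "\<dots> = rho1 m n (h0_proj m n X)"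
  proof -
    have "(\<Sum>k\<in>{m..<m + n}. X $$ (k, k)) = (\<Sum>k<n. X $$ (m + k, m + k))"
      using sum.shift_bounds_nat_ivl[of "\<lambda>k. X $$ (k, k)" 0 m n]
      by (simp add: add.commute lessThan_atLeast0)
    then show ?thesis by (simp add: rho1_h0_proj sum_subtractf sum_distrib_left)
  qed
  finally show ?thesis .
qed

lemma weyl_act_alpha:
  assumes X: "X \<in> g0 m n"
  shows "weyl_act (alpha m n X) p = adj_act m n X p + scl (- rho1 m n (h0_proj m n X)) p"
proof -
  have act_scl: "free_act (scl c a) q = scl c (free_act a q)" for c a q
    by (simp add: free_act_def lin_ext_scl)
  have act_sum: "free_act (sum f A) q = (\<Sum>a\<in>A. free_act (f a) q)" for f and A :: "nat set" and q
    by (induction A rule: infinite_finite_induct) (simp_all add: free_act_add)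
  have act_minus: "free_act (- a) q = - free_act a q" for a q
    using free_act_diff[of 0 a q] by simp
  let ?c = "\<lambda>i j. 2 * B m n X (sbracket m n (xbas m n i) (dbas m n j))"
  let ?L = "\<lambda>i. gminus_poly m n (sbracket m n X (xbas m n i))"
  have "(\<Sum>j<m * n. scl (?c i j) (pvar j * pdiff i p)) = - (?L i * pdiff i p)" if i: "i < m * n" for i
  proof -
    have "?L i = - (\<Sum>j<m * n. scl (?c i j) (pvar j))"
      unfolding gminus_poly_def sum_negf[symmetric]
      by (rule sum.cong) (use i in \<open>simp_all add: B_coefficient[OF X] scl_minus\<close>)
    then show ?thesis by (simp add: sum_distrib_right scl_mult_left)
  qed
  then have 1: "(\<Sum>i<m * n. \<Sum>j<m * n. scl (?c i j) (pvar j * pdiff i p)) = - adj_act m n X p"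
    by (simp add: adj_act_def sum_negf)
  have "(\<Sum>i\<in>A. scl (f i) p) = scl (sum f A) p" for f :: "nat \<Rightarrow> complex" and A
    by (induction A rule: infinite_finite_induct) (simp_all add: scl_add_left)
  then have 2: "(\<Sum>i<m * n. scl (B m n X (sbracket m n (dbas m n i) (xbas m n i))) p) = scl (rho1 m n (h0_proj m n X)) p"
    by (simp add: alpha_constant[OF X])
  show ?thesis
    unfolding alpha_class weyl_act_class
    by (simp add: free_act_diff act_minus act_sum act_scl free_act_mult free_act_gens free_act_one 1 2 scl_minus)
qed

lemma weil_module_g0_module: "g0_module m n (weil_module m n)"
proof -
  let ?V = "weil_module m n"
  have ag: "abelian_group ?V"
    by (rule abelian_groupI)
       (auto simp: weil_module_def polys_add polys_zero algebra_simps intro: polys_uminus bexI[of _ "- x" for x])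
  have mo: "module complex_ring ?V"
    by (rule moduleI[OF complex_ring_cring ag])
       (auto simp: weil_module_def complex_ring_def polys_scl scl_add scl_add_left scl_scl)
  have minus: "a \<ominus>\<^bsub>?V\<^esub> b = a - b" if "b \<in> polys (m * n)" for a b
  proof -
    interpret abelian_group ?V by (rule ag)
    have "\<ominus>\<^bsub>?V\<^esub> b = - b"
      by (rule minus_equality) (use that in \<open>simp_all add: weil_module_def polys_uminus\<close>)
    then show ?thesis by (simp add: a_minus_def weil_module_def)
  qed
  let ?r = "\<lambda>X. rho1 m n (h0_proj m n X)"
  have add: "?r (X + Y) = ?r X + ?r Y" if "X \<in> g0 m n" "Y \<in> g0 m n" for X Y
    using g0_dims[OF that(1)] g0_dims[OF that(2)]
    by (simp add: rho1_h0_proj sum.distrib algebra_simps add_divide_distrib)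
  have scale: "?r (c \<cdot>\<^sub>m X) = c * ?r X" if "X \<in> g0 m n" for X c
    using g0_dims[OF that]
    by (simp add: rho1_h0_proj sum_distrib_left[symmetric] algebra_simps)
  define T where "T X p = adj_act m n X p + scl (- ?r X) p" for X p
  have act: "gact ?V X p = T X p" if "X \<in> g0 m n" for X p
    using weyl_act_alpha[OF that] by (simp add: weil_module_def T_def)
  have sel: "carrier ?V = polys (m * n)" "v \<oplus>\<^bsub>?V\<^esub> w = v + w" "c \<odot>\<^bsub>?V\<^esub> v = scl c v" for v w c
    by (simp_all add: weil_module_def)
  have T_closed: "T X p \<in> polys (m * n)" if "p \<in> polys (m * n)" for X p
    unfolding T_def using that by (intro polys_add adj_act_polys polys_scl)
  have T_right: "T X (p + q) = T X p + T X q" "T X (scl c p) = scl c (T X p)" for X p q c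
    by (simp_all add: T_def adj_act_plus adj_act_scl scl_add scl_scl mult.commute)
  have T_left: "T (X + Y) p = T X p + T Y p" "T (c \<cdot>\<^sub>m X) p = scl c (T X p)"
    if "X \<in> g0 m n" "Y \<in> g0 m n" for X Y p c
    using that by (simp_all add: T_def adj_act_linear_left add scale scl_add scl_diff scl_diff_left scl_scl scl_minus)
  have T_bracket: "T (sbracket m n X Y) p = T X (T Y p) - T Y (T X p)"
    if "X \<in> g0 m n" "Y \<in> g0 m n" for X Y p
    using that unfolding T_def
    by (simp add: adj_act_bracket rho1_bracket adj_act_plus adj_act_scl scl_add scl_scl mult.commute)
  show ?thesis
    unfolding g0_module_def sel
    by (intro conjI ballI allI mo)
       (simp_all add: act T_closed minus g0_add g0_smult sbracket_g0 T_right T_left T_bracket)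
qed


section \<open>Tensoring with a one-dimensional module\<close>

text \<open>
  The carrier of V is a linear subspace of a space of finitely supported functions with its usual
  operations, and W is the line of complex numbers; the actions are left arbitrary. With
  this concrete V the contraction below is a finite linear combination in the ambient space.
\<close>

locale tensor_line =
  fixes V :: "('k \<Rightarrow>\<^sub>0 complex) g0_mod" and W :: "complex g0_mod"
  assumes zero_closed: "0 \<in> carrier V"
    and add_closed: "u \<in> carrier V \<Longrightarrow> v \<in> carrier V \<Longrightarrow> u + v \<in> carrier V"
    and scl_closed: "v \<in> carrier V \<Longrightarrow> scl c v \<in> carrier V"
    and V_add: "u \<oplus>\<^bsub>V\<^esub> v = u + v"
    and V_smult: "c \<odot>\<^bsub>V\<^esub> v = scl c v"
    and W_carrier: "carrier W = UNIV"
    and W_add: "y \<oplus>\<^bsub>W\<^esub> z = y + z"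
    and W_smult: "c \<odot>\<^bsub>W\<^esub> z = c * z"
begin

definition free :: "(('k \<Rightarrow>\<^sub>0 complex) \<times> complex \<Rightarrow>\<^sub>0 complex) set" where
  "free = {f. Poly_Mapping.keys f \<subseteq> carrier V \<times> UNIV}"

definition contract :: "(('k \<Rightarrow>\<^sub>0 complex) \<times> complex \<Rightarrow>\<^sub>0 complex) \<Rightarrow> ('k \<Rightarrow>\<^sub>0 complex)" where
  "contract = lin_ext (\<lambda>(v, z). scl z v)"

definition pure :: "('k \<Rightarrow>\<^sub>0 complex) \<Rightarrow> (('k \<Rightarrow>\<^sub>0 complex) \<times> complex \<Rightarrow>\<^sub>0 complex) set" where
  "pure v = tensor_class V W (Poly_Mapping.single (v, 1) 1)"

lemma sum_closed: "(\<And>a. a \<in> A \<Longrightarrow> f a \<in> carrier V) \<Longrightarrow> sum f A \<in> carrier V"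
  by (induction A rule: infinite_finite_induct) (auto simp: zero_closed add_closed)

lemma free_zero: "0 \<in> free"
  by (simp add: free_def)

lemma free_add: "f \<in> free \<Longrightarrow> g \<in> free \<Longrightarrow> f + g \<in> free"
  using keys_add[of f g] unfolding free_def by blast

lemma free_scl: "f \<in> free \<Longrightarrow> scl c f \<in> free"
  using keys_scl[of c f] unfolding free_def by blast

lemma free_diff: "f \<in> free \<Longrightarrow> g \<in> free \<Longrightarrow> f - g \<in> free"
  using free_add[of f "scl (- 1) g"] free_scl[of g "-1"] by (simp add: scl_minus)

lemma free_sum: "(\<And>a. a \<in> A \<Longrightarrow> f a \<in> free) \<Longrightarrow> sum f A \<in> free"
  by (induction A rule: infinite_finite_induct) (auto simp: free_zero free_add)

lemma free_single: "v \<in> carrier V \<Longrightarrow> Poly_Mapping.single (v, z) c \<in> free"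
  by (simp add: free_def)

lemma contract_linear [simp]:
  "contract (f + g) = contract f + contract g" "contract (f - g) = contract f - contract g"
  "contract (scl c f) = scl c (contract f)" "contract 0 = 0"
  "contract (Poly_Mapping.single (v, z) c) = scl (c * z) v"
  by (simp_all add: contract_def lin_ext_add lin_ext_diff lin_ext_scl lin_ext_single scl_scl)

lemma contract_closed: "f \<in> free \<Longrightarrow> contract f \<in> carrier V"
  unfolding contract_def lin_ext_def free_def
  by (rule sum_closed) (auto intro!: scl_closed)

lemma null_minus: "f \<in> tensor_null V W \<Longrightarrow> - f \<in> tensor_null V W"
  using null_scl[of f V W "-1"] by (simp add: scl_minus)

lemma null_single:
  assumes v: "v \<in> carrier V"
  shows "Poly_Mapping.single (v, z) c - Poly_Mapping.single (scl (c * z) v, 1) 1 \<in> tensor_null V W"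
proof -
  have "Poly_Mapping.single (v, z) 1 - Poly_Mapping.single (v, 1) z \<in> tensor_null V W"
    using rel_smult_right[of v V 1 W z] v by (simp add: W_carrier W_smult)
  from null_scl[OF this, of c]
  have 1: "Poly_Mapping.single (v, z) c - Poly_Mapping.single (v, 1) (c * z) \<in> tensor_null V W"
    by (simp add: scl_diff scl_single)
  have "Poly_Mapping.single (scl (c * z) v, 1) 1 - Poly_Mapping.single (v, 1) (c * z) \<in> tensor_null V W"
    using rel_smult_left[of v V 1 W "c * z"] v by (simp add: W_carrier V_smult)
  from null_add[OF 1 null_minus[OF this]] show ?thesis by simp
qed

text \<open>
  Modulo the bilinearity relations, each generator \<open>c (v, z)\<close> is \<open>(c z v, 1)\<close>, and symbols with second
  component 1 add up; so every element of the free space is congruent to a single such symbol.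
\<close>

lemma null_contract:
  assumes "f \<in> free"
  shows "f - Poly_Mapping.single (contract f, 1) 1 \<in> tensor_null V W"
proof -
  have *: "(\<Sum>k\<in>A. Poly_Mapping.single k (c k))
        - Poly_Mapping.single (contract (\<Sum>k\<in>A. Poly_Mapping.single k (c k)), 1) 1 \<in> tensor_null V W"
    if "finite A" "A \<subseteq> carrier V \<times> UNIV" for A c
    using that
  proof (induction A)
    case empty
    have "Poly_Mapping.single (0, 1) 1 \<in> tensor_null V W"
      using rel_smult_left[OF zero_closed, of 1 W 0] by (simp add: V_smult W_carrier)
    then show ?case using null_minus by fastforce
  next
    case (insert k A)
    obtain v z where k: "k = (v, z)" by (cases k)
    define f where "f = (\<Sum>k\<in>A. Poly_Mapping.single k (c k))"
    define w where "w = scl (c k * z) v"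
    have v: "v \<in> carrier V" using insert k by auto
    have f: "f \<in> free" unfolding f_def using insert.prems by (auto intro!: free_sum free_single)
    have 1: "f - Poly_Mapping.single (contract f, 1) 1 \<in> tensor_null V W"
      using insert unfolding f_def by auto
    have 2: "Poly_Mapping.single (v, z) (c k) - Poly_Mapping.single (w, 1) 1 \<in> tensor_null V W"
      unfolding w_def by (rule null_single[OF v])
    have 3: "Poly_Mapping.single (w + contract f, 1) 1 - Poly_Mapping.single (w, 1) 1
        - Poly_Mapping.single (contract f, 1) 1 \<in> tensor_null V W"
      using rel_add_left[of w V "contract f" 1 W] contract_closed[OF f] scl_closed[OF v]
      by (simp add: w_def V_add W_carrier)
    have "(\<Sum>k\<in>insert k A. Poly_Mapping.single k (c k)) = Poly_Mapping.single (v, z) (c k) + f"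
      using insert by (simp add: f_def k)
    then show ?case
      using null_add[OF null_add[OF 1 2] null_minus[OF 3]] by (simp add: w_def k algebra_simps)
  qed
  have "f = (\<Sum>k\<in>Poly_Mapping.keys f. Poly_Mapping.single k (Poly_Mapping.lookup f k))"
    by (rule poly_mapping_eqI)
       (auto simp: lookup_sum lookup_single when_def in_keys_iff)
  then show ?thesis
    using *[of "Poly_Mapping.keys f" "Poly_Mapping.lookup f"] assms by (simp add: free_def)
qed

text \<open>
  The contraction respects the bilinearity relations, and an element that it kills is congruent
  to \<open>(0, 1)\<close>, itself a relation. This replaces the generated subspace by a kernel.
\<close>

lemma tensor_null_iff: "f \<in> tensor_null V W \<longleftrightarrow> f \<in> free \<and> contract f = 0"
proof
  assume "f \<in> tensor_null V W"
  then show "f \<in> free \<and> contract f = 0"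
    by induction
       (simp_all add: free_zero free_add free_scl free_diff free_single add_closed scl_closed
         V_add V_smult W_add W_smult scl_add scl_add_left scl_scl mult.commute)
next
  assume f: "f \<in> free \<and> contract f = 0"
  have "Poly_Mapping.single (0, 1) 1 \<in> tensor_null V W"
    using rel_smult_left[OF zero_closed, of 1 W 0] by (simp add: V_smult W_carrier)
  from null_add[OF null_contract this] f show "f \<in> tensor_null V W" by fastforce
qed

lemma tensor_class_eq:
  assumes "f \<in> free"
  shows "tensor_class V W f = {g \<in> free. contract g = contract f}"
proof -
  have "g \<in> tensor_class V W f" if "g \<in> free" "contract g = contract f" for g
    unfolding tensor_class_def mem_Collect_eq
    by (intro exI[of _ "g - f"]) (use that assms in \<open>simp add: tensor_null_iff free_diff\<close>)
  then show ?thesis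
    using assms by (auto simp: tensor_class_def tensor_null_iff free_add)
qed

lemma pure_eq: "v \<in> carrier V \<Longrightarrow> pure v = {g \<in> free. contract g = v}"
  by (simp add: pure_def tensor_class_eq free_single)

lemma tensor_class_pure: "f \<in> free \<Longrightarrow> tensor_class V W f = pure (contract f)"
  by (simp add: tensor_class_eq pure_eq contract_closed)

lemma single_in_pure: "v \<in> carrier V \<Longrightarrow> Poly_Mapping.single (v, 1) 1 \<in> pure v"
  by (simp add: pure_eq free_single)

lemma pure_bij: "bij_betw pure (carrier V) (carrier (tensor_module V W))"
  unfolding bij_betw_def
proof
  show "inj_on pure (carrier V)"
  proof (rule inj_onI)
    fix u v assume "u \<in> carrier V" "v \<in> carrier V" "pure u = pure v"
    then have "Poly_Mapping.single (u, 1) 1 \<in> pure v" using single_in_pure by blast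
    then show "u = v" using \<open>v \<in> carrier V\<close> by (simp add: pure_eq)
  qed
  have "carrier (tensor_module V W) = tensor_class V W ` free"
    by (simp add: tensor_module_def free_def W_carrier)
  also have "\<dots> = pure ` contract ` free"
    by (simp add: image_image tensor_class_pure cong: image_cong)
  also have "contract ` free = carrier V"
    using contract_closed free_single[of _ 1 1] by (force simp: image_iff intro: bexI[of _ "Poly_Mapping.single (v, 1) 1" for v])
  finally show "pure ` carrier V = carrier (tensor_module V W)" ..
qed

lemma pure_add:
  assumes u: "u \<in> carrier V" and v: "v \<in> carrier V"
  shows "pure u \<oplus>\<^bsub>tensor_module V W\<^esub> pure v = pure (u + v)"
proof -
  have "tensor_class V W (f + g) = pure (u + v)" if "f \<in> pure u" "g \<in> pure v" for f g
    using that u v by (simp add: pure_eq[of u] pure_eq[of v] tensor_class_pure free_add)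
  then show ?thesis
    using single_in_pure[OF u] single_in_pure[OF v] by (auto simp: tensor_module_def)
qed

lemma pure_smult:
  assumes v: "v \<in> carrier V"
  shows "c \<odot>\<^bsub>tensor_module V W\<^esub> pure v = pure (scl c v)"
proof -
  have "tensor_class V W (scl c f) = pure (scl c v)" if "f \<in> pure v" for f
    using that v by (simp add: pure_eq[of v] tensor_class_pure free_scl)
  then show ?thesis
    using single_in_pure[OF v] by (auto simp: tensor_module_def)
qed

lemma pure_zero: "\<zero>\<^bsub>tensor_module V W\<^esub> = pure 0"
  by (simp add: tensor_module_def tensor_class_pure free_zero)

text \<open>
  By the Leibniz rule X acts as \<open>gact V X + c\<close> after contraction. This has to be checked on every
  representative of \<open>v \<otimes> 1\<close>, as the action on the quotient is a union over all of them.
\<close>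

lemma pure_gact:
  assumes v: "v \<in> carrier V"
    and closed: "\<And>u. u \<in> carrier V \<Longrightarrow> gact V X u \<in> carrier V"
    and add: "\<And>u w. u \<in> carrier V \<Longrightarrow> w \<in> carrier V \<Longrightarrow> gact V X (u + w) = gact V X u + gact V X w"
    and scale: "\<And>d u. u \<in> carrier V \<Longrightarrow> gact V X (scl d u) = scl d (gact V X u)"
    and weight: "\<And>z. gact W X z = c * z"
  shows "gact (tensor_module V W) X (pure v) = pure (gact V X v + scl c v)"
proof -
  let ?T = "\<lambda>u. gact V X u + scl c u"
  let ?h = "\<lambda>(u, z). Poly_Mapping.single (gact V X u, z) 1 + Poly_Mapping.single (u, gact W X z) 1"
  have T_sum: "?T (\<Sum>k\<in>A. scl (a k) (u k)) = (\<Sum>k\<in>A. scl (a k) (?T (u k)))"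
    if "finite A" "\<And>k. k \<in> A \<Longrightarrow> u k \<in> carrier V" for A :: "'b set" and a u
    using that
  proof (induction A)
    case empty
    then show ?case using scale[OF zero_closed, of 0] by simp
  next
    case (insert k A)
    have u: "scl (a k) (u k) \<in> carrier V" "(\<Sum>k\<in>A. scl (a k) (u k)) \<in> carrier V"
      using insert.prems by (auto intro!: scl_closed sum_closed)
    have "?T (\<Sum>k\<in>insert k A. scl (a k) (u k)) = ?T (scl (a k) (u k)) + ?T (\<Sum>k\<in>A. scl (a k) (u k))"
      using insert.hyps by (simp add: add[OF u] scl_add)
    also have "\<dots> = scl (a k) (?T (u k)) + (\<Sum>k\<in>A. scl (a k) (?T (u k)))"
      using insert by (simp add: scale scl_add scl_scl mult.commute)
    finally show ?case using insert.hyps by simp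
  qed
  have "tensor_class V W (tensor_free_act V W X f) = pure (?T v)" if f: "f \<in> pure v" for f
  proof -
    have f: "f \<in> free" "contract f = v" using that v by (auto simp: pure_eq)
    let ?K = "Poly_Mapping.keys f" and ?f = "Poly_Mapping.lookup f"
    have K: "fst k \<in> carrier V" if "k \<in> ?K" for k using f(1) that by (auto simp: free_def)
    have h: "?h k \<in> free" if "k \<in> ?K" for k
      using K[OF that] by (cases k) (auto intro!: free_add free_single closed)
    have e: "tensor_free_act V W X f = (\<Sum>k\<in>?K. scl (?f k) (?h k))"
      by (simp add: tensor_free_act_def lin_ext_def)
    have c_sum: "contract (sum g A) = (\<Sum>k\<in>A. contract (g k))" for g and A :: "(('k \<Rightarrow>\<^sub>0 complex) \<times> complex) set"
      by (induction A rule: infinite_finite_induct) simp_all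
    have "contract (tensor_free_act V W X f) = (\<Sum>k\<in>?K. scl (?f k * snd k) (?T (fst k)))"
      unfolding e c_sum
      by (intro sum.cong) (auto simp: weight scl_add scl_scl mult_ac)
    also have "\<dots> = ?T (\<Sum>k\<in>?K. scl (?f k * snd k) (fst k))"
      using K by (subst T_sum) simp_all
    also have "(\<Sum>k\<in>?K. scl (?f k * snd k) (fst k)) = v"
      using f(2) by (simp add: contract_def lin_ext_def split_def scl_scl)
    finally show ?thesis
      using tensor_class_pure[of "tensor_free_act V W X f"] h by (simp add: e free_sum free_scl)
  qed
  then show ?thesis
    using single_in_pure[OF v] by (auto simp: tensor_module_def)
qed

end


section \<open>Transport of structure\<close>

text \<open>
  The module laws of the target are images of those of the source under the bijection, so they
  need no separate verification for the tensor product.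
\<close>

lemma g0_iso_transport:
  assumes V: "g0_module m n V"
    and bij: "bij_betw \<phi> (carrier V) (carrier W)"
    and zero: "\<phi> \<zero>\<^bsub>V\<^esub> = \<zero>\<^bsub>W\<^esub>"
    and add: "\<And>v w. v \<in> carrier V \<Longrightarrow> w \<in> carrier V \<Longrightarrow> \<phi> (v \<oplus>\<^bsub>V\<^esub> w) = \<phi> v \<oplus>\<^bsub>W\<^esub> \<phi> w"
    and smult: "\<And>c v. v \<in> carrier V \<Longrightarrow> \<phi> (c \<odot>\<^bsub>V\<^esub> v) = c \<odot>\<^bsub>W\<^esub> \<phi> v"
    and act: "\<And>X v. X \<in> g0 m n \<Longrightarrow> v \<in> carrier V \<Longrightarrow> \<phi> (gact V X v) = gact W X (\<phi> v)"
  shows "g0_iso m n V W \<phi>"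
proof -
  interpret V: module complex_ring V using V by (simp add: g0_module_def)
  have im: "carrier W = \<phi> ` carrier V" using bij by (simp add: bij_betw_def)
  note hom = zero[symmetric] add[symmetric] smult[symmetric] act[symmetric]
  have C: "carrier complex_ring = UNIV" by (simp add: complex_ring_def)
  have ag: "abelian_group W"
  proof (rule abelian_groupI)
    fix x assume "x \<in> carrier W"
    then obtain v where v: "x = \<phi> v" "v \<in> carrier V" by (auto simp: im)
    show "\<exists>y\<in>carrier W. y \<oplus>\<^bsub>W\<^esub> x = \<zero>\<^bsub>W\<^esub>"
      by (rule bexI[of _ "\<phi> (\<ominus>\<^bsub>V\<^esub> v)"]) (use v in \<open>simp_all add: hom im V.M.l_neg\<close>)
  qed (auto simp: im hom V.M.add.m_ac)
  have mo: "module complex_ring W"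
    by (rule moduleI[OF complex_ring_cring ag])
       (auto simp: im hom C V.smult_closed V.smult_l_distr V.smult_r_distr V.smult_assoc1 V.smult_one)
  have minus: "\<phi> (u \<ominus>\<^bsub>V\<^esub> v) = \<phi> u \<ominus>\<^bsub>W\<^esub> \<phi> v" if "u \<in> carrier V" "v \<in> carrier V" for u v
  proof -
    interpret W: abelian_group W by (rule ag)
    have "\<ominus>\<^bsub>W\<^esub> \<phi> v = \<phi> (\<ominus>\<^bsub>V\<^esub> v)"
      by (rule W.minus_equality) (use that in \<open>simp_all add: hom im V.M.l_neg\<close>)
    then show ?thesis using that by (simp add: a_minus_def add)
  qed
  have "g0_module m n W"
    unfolding g0_module_def im
    using V mo unfolding g0_module_def
    by (auto simp: hom minus[symmetric] V.smult_closed C g0_add g0_smult sbracket_g0)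
  then show ?thesis
    using V bij add smult act by (simp add: g0_iso_def)
qed


section \<open>The isomorphism\<close>

theorem proposition7:
  fixes m n :: nat
  shows "\<exists>\<phi>. g0_iso m n (weil_module m n)
              (tensor_module (adj_module m n) (minus_rho1_module m n)) \<phi>"
proof -
  interpret T: tensor_line "adj_module m n" "minus_rho1_module m n"
    by unfold_locales
       (simp_all add: adj_module_def minus_rho1_module_def polys_zero polys_add polys_scl)
  have sel: "carrier (adj_module m n) = carrier (weil_module m n)"
    "gact (adj_module m n) = adj_act m n" "carrier (weil_module m n) = polys (m * n)"
    by (simp_all add: adj_module_def weil_module_def)
  have "g0_iso m n (weil_module m n) (tensor_module (adj_module m n) (minus_rho1_module m n)) T.pure"
  proof (rule g0_iso_transport[OF weil_module_g0_module])
    show "bij_betw T.pure (carrier (weil_module m n))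
        (carrier (tensor_module (adj_module m n) (minus_rho1_module m n)))"
      using T.pure_bij by (simp only: sel)
    show "T.pure \<zero>\<^bsub>weil_module m n\<^esub> = \<zero>\<^bsub>tensor_module (adj_module m n) (minus_rho1_module m n)\<^esub>"
      by (simp add: T.pure_zero weil_module_def)
    fix v assume v: "v \<in> carrier (weil_module m n)"
    then show "T.pure (v \<oplus>\<^bsub>weil_module m n\<^esub> w) =
        T.pure v \<oplus>\<^bsub>tensor_module (adj_module m n) (minus_rho1_module m n)\<^esub> T.pure w"
      if "w \<in> carrier (weil_module m n)" for w
      using that T.pure_add[of v w] by (simp add: sel) (simp add: weil_module_def)
    show "T.pure (c \<odot>\<^bsub>weil_module m n\<^esub> v) =
        c \<odot>\<^bsub>tensor_module (adj_module m n) (minus_rho1_module m n)\<^esub> T.pure v" for c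
      using v T.pure_smult[of v c] by (simp add: sel) (simp add: weil_module_def)
    fix X assume X: "X \<in> g0 m n"
    have "gact (tensor_module (adj_module m n) (minus_rho1_module m n)) X (T.pure v) =
        T.pure (gact (adj_module m n) X v + scl (- rho1 m n (h0_proj m n X)) v)"
      by (rule T.pure_gact)
         (use v in \<open>simp_all add: sel adj_act_polys adj_act_plus adj_act_scl minus_rho1_module_def\<close>)
    then show "T.pure (gact (weil_module m n) X v) =
        gact (tensor_module (adj_module m n) (minus_rho1_module m n)) X (T.pure v)"
      by (simp add: sel weyl_act_alpha[OF X]) (simp add: weil_module_def weyl_act_alpha[OF X])
  qed
  then show ?thesis by blast
qed

end
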